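(* Let assumption (A) of the context hold and let $\alpha\in(0,\tfrac2{\eta+L}]$. Consider the variance-reduced SGD algorithm $$x_{k+1}=x_k-\alpha\,(\nabla f(x_k)+w_{k,N_k}),\qquad k\ge 0,$$ where $N_k=\lceil\rho_1^{-(k+1)}\rceil$ for some $\rho_1\in(q,1)$ with $q=1-\tfrac{2\alpha\eta L}{\eta+L}$. Then $$\mathbb E[\|x_k-x^*\|^2]\le \rho_1^k\Big(\mathbb E[\|x_0-x^*\|^2]+\frac{\alpha^2\nu^2}{1-q/\rho_1}\Big)\quad\forall k\ge1.$$ The iteration and oracle complexity for computing an $\epsilon$-solution, defined as $\mathbb E[\|x_k-x^*\|^2]\le\epsilon$, are $\mathcal O(\kappa\ln(1/\epsilon))$ and $\mathcal O(\kappa/\epsilon)$, respectively, where $\kappa=L/\eta$ denotes the condition number.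
   Context: Problem: minimize $f(x)=\mathbb E[F(x,\boldsymbol\xi)]$ over $x\in\mathbb R^m$, where $\boldsymbol\xi$ is an $\mathbb R^d$-valued random vector and $F:\mathbb R^m\times\mathbb R^d\to\mathbb R$. Sampled gradients $\nabla F(x,\xi)$ (gradient in $x$) are available. Given $x_0\in\mathbb R^m$ and positive integers $N_k$ (batch sizes), $\xi_{j,k}$ ($1\le j\le N_k$, $k\ge 0$) are i.i.d. copies of $\boldsymbol\xi$; $w_{k,N_k}=\frac1{N_k}\sum_{j=1}^{N_k}\nabla F(x_k,\xi_{j,k})-\nabla f(x_k)$; and $\mathcal F_k=\sigma\{x_0,\xi_{j,t}:1\le j\le N_t,\,0\le t\le k-1\}$, so $x_k$ is $\mathcal F_k$-measurable. Assumption (A): (i) $f$ is continuously differentiable on $\mathbb R^m$ and $\|\nabla f(x)-\nabla f(x')\|\le L\|x-x'\|$ for all $x,x'$, with $L>0$; (ii) $f$ is $\eta$-strongly convex, $\eta>0$: $(\nabla f(x)-\nabla f(x'))^T(x-x')\ge\eta\|x-x'\|^2$ for all $x,x'$; (iii) there is $\nu>0$ such that for all $k\ge0$ and $1\le j\le N_k$, almost surely $\mathbb E[\nabla F(x_k,\xi_{j,k})\mid\mathcal F_k]=\nabla f(x_k)$ and $\mathbb E[\|\nabla F(x_k,\xi_{j,k})-\nabla f(x_k)\|^2\mid\mathcal F_k]\le\nu^2$. The unique minimizer of $f$ is denoted $x^*$. Iteration complexity is the number of iterations, and oracle complexity the total number of sampled gradients, needed to obtain an $\epsilon$-solution. *)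

theory Defs
  imports "HOL-Probability.Probability"
begin

definition grad :: "('a::real_inner \<Rightarrow> real) \<Rightarrow> 'a \<Rightarrow> 'a" where
  "grad g y = (THE D. GDERIV g y :> D)"

text \<open>
  Given a batch \<open>s 1, \<dots>, s n\<close>, this is the averaged sampled gradient minus the true gradient at \<open>y\<close>.
\<close>

definition batch_error ::
    "('a::real_inner \<Rightarrow> 'b \<Rightarrow> real) \<Rightarrow> ('a \<Rightarrow> real) \<Rightarrow> nat \<Rightarrow> (nat \<Rightarrow> 'b) \<Rightarrow> 'a \<Rightarrow> 'a" where
  "batch_error F f n s y = (1 / real n) *\<^sub>R (\<Sum>j = 1..n. grad (\<lambda>z. F z (s j)) y) - grad f y"

definition sample_index :: "(nat \<Rightarrow> nat) \<Rightarrow> (nat \<times> nat) set" where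
  "sample_index N = {(j, k). 1 \<le> j \<and> j \<le> N k}"

text \<open>
  The sigma-algebra generated by \<open>x0\<close> and all samples \<open>\<xi>s j t\<close> with \<open>1 \<le> j \<le> N t\<close> and \<open>t < k\<close>.
\<close>

definition history ::
    "'w measure \<Rightarrow> ('w \<Rightarrow> 'a::topological_space) \<Rightarrow> (nat \<Rightarrow> nat \<Rightarrow> 'w \<Rightarrow> 'b::topological_space)
      \<Rightarrow> (nat \<Rightarrow> nat) \<Rightarrow> nat \<Rightarrow> 'w measure" where
  "history M x0 \<xi>s N k = sigma (space M)
     ({x0 -` A \<inter> space M | A. A \<in> sets borel} \<union>
      {\<xi>s j t -` A \<inter> space M | j t A. t < k \<and> (j, t) \<in> sample_index N \<and> A \<in> sets borel})"

text \<open>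
  Stochastic gradient descent with batch sizes \<open>N k\<close>; \<open>\<xi>s j k\<close> is the \<open>j\<close>-th sample of
  iteration \<open>k\<close>. The initial iterate \<open>X 0\<close> may be random, in which case it is square integrable
  and independent of the samples; a deterministic initial point is the special case of a
  constant function. The nonnegative conditional expectation is used for the variance bound, so
  no integrability of the sampled gradients is presupposed.
\<close>

locale batch_sgd = prob_space M for M :: "'w measure" +
  fixes F :: "real ^ 'm \<Rightarrow> real ^ 'd \<Rightarrow> real"
    and \<xi> :: "'w \<Rightarrow> real ^ 'd"
    and \<xi>s :: "nat \<Rightarrow> nat \<Rightarrow> 'w \<Rightarrow> real ^ 'd"
    and N :: "nat \<Rightarrow> nat"
    and f :: "real ^ 'm \<Rightarrow> real"
    and xmin :: "real ^ 'm"
    and X :: "nat \<Rightarrow> 'w \<Rightarrow> real ^ 'm"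
    and \<alpha> \<eta> L \<nu> :: real
  assumes F_measurable: "case_prod F \<in> borel_measurable (borel \<Otimes>\<^sub>M borel)"
    and F_differentiable: "\<And>y s. (\<lambda>z. F z s) differentiable (at y)"
    and xi_measurable: "\<xi> \<in> borel_measurable M"
    and F_integrable: "\<And>y. integrable M (\<lambda>\<omega>. F y (\<xi> \<omega>))"
    and f_eq: "\<And>y. f y = expectation (\<lambda>\<omega>. F y (\<xi> \<omega>))"
    and N_pos: "\<And>k. 0 < N k"
    and samples_indep: "indep_vars (\<lambda>_. borel) (\<lambda>(j, k). \<xi>s j k) (sample_index N)"
    and samples_distr: "\<And>j k. (j, k) \<in> sample_index N \<Longrightarrow> distr M borel (\<xi>s j k) = distr M borel \<xi>"
    and init_measurable: "X 0 \<in> borel_measurable M"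
    and init_square_integrable: "integrable M (\<lambda>\<omega>. (norm (X 0 \<omega>))\<^sup>2)"
    and init_indep: "indep_set (sets (vimage_algebra (space M) (X 0) borel))
          (sigma_sets (space M)
            {\<xi>s j k -` A \<inter> space M | j k A. (j, k) \<in> sample_index N \<and> A \<in> sets borel})"
    and X_Suc: "\<And>k \<omega>. \<omega> \<in> space M \<Longrightarrow>
          X (Suc k) \<omega> = X k \<omega> - \<alpha> *\<^sub>R (grad f (X k \<omega>) + batch_error F f (N k) (\<lambda>j. \<xi>s j k \<omega>) (X k \<omega>))"
    and f_differentiable: "\<And>y. f differentiable (at y)"
    and grad_f_continuous: "continuous_on UNIV (grad f)"
    and L_pos: "0 < L"
    and grad_f_lipschitz: "\<And>y z. norm (grad f y - grad f z) \<le> L * norm (y - z)"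
    and eta_pos: "0 < \<eta>"
    and strongly_convex: "\<And>y z. (grad f y - grad f z) \<bullet> (y - z) \<ge> \<eta> * (norm (y - z))\<^sup>2"
    and nu_pos: "0 < \<nu>"
    and unbiased: "\<And>j k i. (j, k) \<in> sample_index N \<Longrightarrow>
          AE \<omega> in M. real_cond_exp M (history M (X 0) \<xi>s N k)
              (\<lambda>\<omega>. grad (\<lambda>z. F z (\<xi>s j k \<omega>)) (X k \<omega>) $ i) \<omega> = grad f (X k \<omega>) $ i"
    and variance_bound: "\<And>j k. (j, k) \<in> sample_index N \<Longrightarrow>
          AE \<omega> in M. nn_cond_exp M (history M (X 0) \<xi>s N k)
              (\<lambda>\<omega>. ennreal ((norm (grad (\<lambda>z. F z (\<xi>s j k \<omega>)) (X k \<omega>) - grad f (X k \<omega>)))\<^sup>2)) \<omega>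
            \<le> ennreal (\<nu>\<^sup>2)"
    and minimizer: "\<And>y. f xmin \<le> f y"

definition contraction :: "real \<Rightarrow> real \<Rightarrow> real \<Rightarrow> real" where
  "contraction \<alpha> \<eta> L = 1 - 2 * \<alpha> * \<eta> * L / (\<eta> + L)"

locale geometric_batch_sgd = batch_sgd M F \<xi> \<xi>s N f xmin X \<alpha> \<eta> L \<nu>
  for M :: "'w measure"
    and F :: "real ^ 'm \<Rightarrow> real ^ 'd \<Rightarrow> real"
    and \<xi> \<xi>s N f xmin X \<alpha> \<eta> L \<nu> +
  fixes \<rho> :: real
  assumes alpha_pos: "0 < \<alpha>"
    and alpha_le: "\<alpha> \<le> 2 / (\<eta> + L)"
    and rho_gt: "contraction \<alpha> \<eta> L < \<rho>"
    and rho_less: "\<rho> < 1"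
    and N_eq: "\<And>k. N k = nat \<lceil>\<rho> powi (- int (k + 1))\<rceil>"

definition mse :: "'w measure \<Rightarrow> (nat \<Rightarrow> 'w \<Rightarrow> 'a::real_normed_vector) \<Rightarrow> 'a \<Rightarrow> nat \<Rightarrow> real" where
  "mse M X xmin k = (\<integral>\<omega>. (norm (X k \<omega> - xmin))\<^sup>2 \<partial>M)"

text \<open>
  Both complexities are meaningful only if some iterate is an \<open>\<epsilon>\<close>-solution.
\<close>

definition iteration_complexity ::
    "'w measure \<Rightarrow> (nat \<Rightarrow> 'w \<Rightarrow> 'a::real_normed_vector) \<Rightarrow> 'a \<Rightarrow> real \<Rightarrow> nat" where
  "iteration_complexity M X xmin \<epsilon> = (LEAST k. mse M X xmin k \<le> \<epsilon>)"

definition oracle_complexity ::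
    "'w measure \<Rightarrow> (nat \<Rightarrow> 'w \<Rightarrow> 'a::real_normed_vector) \<Rightarrow> 'a \<Rightarrow> (nat \<Rightarrow> nat) \<Rightarrow> real \<Rightarrow> nat" where
  "oracle_complexity M X xmin N \<epsilon> = (\<Sum>k < iteration_complexity M X xmin \<epsilon>. N k)"

text \<open>
  The order bounds \<open>O(\<kappa> ln (1/\<epsilon>))\<close> and \<open>O(\<kappa>/\<epsilon>)\<close> with \<open>\<kappa> = L/\<eta>\<close>: the constant \<open>C\<close> and the range
  \<open>(0, \<epsilon>\<^sub>0]\<close> of accuracies do not depend on \<open>\<eta>\<close>, \<open>L\<close> or the problem instance. They depend only
  on

  \<^item> the relative step length \<open>a = \<alpha> (\<eta> + L)\<close>, which ranges over \<open>(0, 2]\<close>;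
  \<^item> the relative position \<open>c = (1 - \<rho>) / (1 - q)\<close> of \<open>\<rho>\<close> in \<open>(q, 1)\<close>, which ranges over \<open>(0, 1)\<close>;
  \<^item> a bound \<open>D\<close> on the initial error and a bound \<open>S\<close> on the scaled noise level \<open>\<nu>\<^sup>2 / (\<eta> L)\<close>.

  Every instance satisfies these side conditions for suitable \<open>a\<close>, \<open>c\<close>, \<open>D\<close>, \<open>S\<close>. Some such
  normalisation is unavoidable: for example, \<open>1 / ln (1/\<rho>)\<close> is not bounded by a multiple of \<open>\<kappa>\<close>
  when \<open>\<alpha>\<close> tends to \<open>0\<close> or \<open>\<rho>\<close> tends to \<open>1\<close>.
\<close>

end

theory Submission
  imports Defs
begin

text \<open>
  Baillon--Haddad cocoercivity, applied to \<open>f - (\<eta> / 2) * norm\<^sup>2\<close>, makes an exact gradient step with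
  \<open>\<alpha> \<le> 2 / (\<eta> + L)\<close> contract the squared distance to the minimizer by the factor \<open>q\<close>. The batch
  error is orthogonal to every square integrable function of the past, and distinct samples of one
  batch have orthogonal errors, so that
  \<open>e (k + 1) \<le> q * e k + \<alpha>\<^sup>2 * \<nu>\<^sup>2 / N k\<close>; with \<open>1 / N k \<le> \<rho> ^ (k + 1)\<close> this gives
  \<open>e k \<le> B * \<rho> ^ k\<close>. The first \<open>k\<close> with \<open>e k \<le> \<epsilon>\<close> is thus of order \<open>ln (B / \<epsilon>) / (1 - \<rho>)\<close>, and since \<open>\<epsilon>\<close> is
  not yet reached one step earlier, the geometric sum of the batch sizes is of order
  \<open>B / (\<epsilon> * (1 - \<rho>))\<close>, where \<open>1 / (1 - \<rho>)\<close> is of order \<open>L / \<eta>\<close>.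
\<close>

section \<open>Gradient steps for smooth strongly convex functions\<close>

text \<open>\<open>grad\<close> is a definite description, so a gradient must be shown to exist and
  to be unique before anything follows about it. Existence is the Riesz representation of the
  derivative, with \<open>D\<close> assembled from its values on \<open>Basis\<close>.\<close>

lemma gderiv_grad:
  fixes f :: "'a::euclidean_space \<Rightarrow> real"
  assumes "f differentiable (at y)"
  shows "GDERIV f y :> grad f y"
proof -
  obtain f' where f': "(f has_derivative f') (at y)"
    using assms by (auto simp: differentiable_def)
  interpret f': bounded_linear f'
    using f' by (rule has_derivative_bounded_linear)
  define D where "D = (\<Sum>b\<in>Basis. f' b *\<^sub>R b)"
  have "f' h = h \<bullet> D" for h
  proof -
    have "f' h = f' (\<Sum>b\<in>Basis. (h \<bullet> b) *\<^sub>R b)"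
      by (simp add: euclidean_representation)
    also have "\<dots> = h \<bullet> D"
      by (simp add: f'.sum f'.scaleR D_def inner_sum_right mult.commute)
    finally show ?thesis .
  qed
  then have f'_eq: "f' = (\<lambda>h. h \<bullet> D)"
    by auto
  have D: "GDERIV f y :> D"
    using f' by (simp add: gderiv_def f'_eq)
  have "D' = D" if "GDERIV f y :> D'" for D'
  proof -
    have "(\<lambda>h. h \<bullet> D') = (\<lambda>h. h \<bullet> D)"
      using that D has_derivative_unique unfolding gderiv_def by blast
    then have "(D' - D) \<bullet> (D' - D) = 0"
      by (simp add: inner_diff_right fun_eq_iff)
    then show ?thesis by simp
  qed
  with D show ?thesis
    unfolding grad_def by (rule theI)
qed

text \<open>Restriction to a line makes one-variable calculus available, both for the quadratic
  bounds and for the difference quotients in \<open>borel_measurable_grad\<close>.\<close>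

lemma gderiv_line:
  assumes "\<And>z. GDERIV g z :> G z"
  shows "((\<lambda>t. g (x + t *\<^sub>R d)) has_real_derivative G (x + t *\<^sub>R d) \<bullet> d) (at t)"
proof -
  have "((\<lambda>t. g (x + t *\<^sub>R d)) has_derivative (\<lambda>h. (h *\<^sub>R d) \<bullet> G (x + t *\<^sub>R d))) (at t)"
    by (rule has_derivative_compose[of "\<lambda>t. x + t *\<^sub>R d" "\<lambda>h. h *\<^sub>R d" t UNIV g,
          OF _ assms[unfolded gderiv_def]])
      (auto intro!: derivative_eq_intros)
  moreover have "(\<lambda>h. (h *\<^sub>R d) \<bullet> G (x + t *\<^sub>R d)) = (*) (G (x + t *\<^sub>R d) \<bullet> d)"
    by (auto simp: fun_eq_iff inner_commute)
  ultimately show ?thesis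
    unfolding has_field_derivative_def by simp
qed

lemma grad_eq_0_at_minimum:
  fixes f :: "'a::euclidean_space \<Rightarrow> real"
  assumes "f differentiable (at x)" "\<And>y. f x \<le> f y"
  shows "grad f x = 0"
proof -
  have "(\<lambda>h. h \<bullet> grad f x) = (\<lambda>h. 0)"
    using gderiv_grad[OF assms(1)] assms(2) unfolding gderiv_def
    by (intro differential_zero_maxmin[of x UNIV f]) auto
  then show ?thesis
    by (metis inner_eq_zero_iff)
qed

text \<open>Along the segment from \<open>x\<close> to \<open>y\<close>, the difference between
  \<open>g\<close> and the claimed bound has nonnegative derivative. The sign of \<open>c\<close> is
  left free: \<open>c = 0\<close> gives the tangent inequality, and negative \<open>c\<close> serves
  the upper bound.\<close>

lemma gradient_lower_quadratic:
  assumes G: "\<And>z. GDERIV g z :> G z"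
    and low: "\<And>y z. (G y - G z) \<bullet> (y - z) \<ge> c * (norm (y - z))\<^sup>2"
  shows "g y \<ge> g x + G x \<bullet> (y - x) + c / 2 * (norm (y - x))\<^sup>2"
proof -
  define d where "d = y - x"
  define p where "p t = g (x + t *\<^sub>R d) - t * (G x \<bullet> d) - c * t\<^sup>2 / 2 * (norm d)\<^sup>2" for t
  have "p 0 \<le> p 1"
  proof (rule DERIV_nonneg_imp_nondecreasing[of 0 1 p])
    fix t :: real assume t: "0 \<le> t" "t \<le> 1"
    let ?p' = "G (x + t *\<^sub>R d) \<bullet> d - G x \<bullet> d - c * t * (norm d)\<^sup>2"
    have "(p has_real_derivative ?p') (at t)"
      unfolding p_def by (rule derivative_eq_intros gderiv_line[OF G] refl | simp)+
    \<comment> \<open>The hypothesis at \<open>x + t *\<^sub>R d\<close> and \<open>x\<close>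
      controls only \<open>t * ?p'\<close>; dividing by \<open>t\<close> leaves \<open>t = 0\<close>
      apart, where \<open>?p'\<close> is zero.\<close>
    moreover have "?p' \<ge> 0"
    proof (cases "t = 0")
      case False
      with low[of "x + t *\<^sub>R d" x] t have "t * ?p' \<ge> 0"
        by (simp add: inner_diff_left power_mult_distrib algebra_simps power2_eq_square)
      with t False show ?thesis
        by (simp add: zero_le_mult_iff)
    qed simp
    ultimately show "\<exists>y. (p has_real_derivative y) (at t) \<and> y \<ge> 0" by blast
  qed simp
  then show ?thesis
    by (simp add: p_def d_def)
qed

text \<open>This is the lower bound for \<open>- g\<close> with the constant
  \<open>- c\<close>.\<close>

lemma gradient_upper_quadratic:
  assumes G: "\<And>z. GDERIV g z :> G z"
    and up: "\<And>y z. (G y - G z) \<bullet> (y - z) \<le> c * (norm (y - z))\<^sup>2"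
  shows "g y \<le> g x + G x \<bullet> (y - x) + c / 2 * (norm (y - x))\<^sup>2"
proof -
  have "- g x + - G x \<bullet> (y - x) + - c / 2 * (norm (y - x))\<^sup>2 \<le> - g y"
  proof (rule gradient_lower_quadratic[OF GDERIV_minus[OF G]])
    show "- c * (norm (y - z))\<^sup>2 \<le> (- G y - - G z) \<bullet> (y - z)" for y z
      using up[of y z] by (simp add: inner_diff_left)
  qed
  then show ?thesis by simp
qed

text \<open>
  For fixed \<open>x\<close> the tilted function \<open>z \<mapsto> g z - G x \<bullet> z\<close> is minimal at \<open>x\<close>, while a gradient
  step of length \<open>1 / c\<close> from \<open>y\<close> decreases it by at least \<open>(norm (G y - G x))\<^sup>2 / (2 * c)\<close>.
\<close>

lemma cocoercive:
  assumes G: "\<And>z. GDERIV g z :> G z"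
    and mono: "\<And>y z. (G y - G z) \<bullet> (y - z) \<ge> 0"
    and up: "\<And>y z. (G y - G z) \<bullet> (y - z) \<le> c * (norm (y - z))\<^sup>2"
    and "c > 0"
  shows "(norm (G y - G x))\<^sup>2 \<le> c * ((G y - G x) \<bullet> (y - x))"
proof -
  have gap: "(norm (G y - G x))\<^sup>2 / (2 * c) \<le> g y - g x - G x \<bullet> (y - x)" for x y
  proof -
    define u where "u = G y - G x"
    define z where "z = y - (1 / c) *\<^sub>R u"
    have "g x + G x \<bullet> (z - x) \<le> g z"
      using gradient_lower_quadratic[OF G, of 0 x z] mono by simp
    also have "g z \<le> g y + G y \<bullet> (z - y) + c / 2 * (norm (z - y))\<^sup>2"
      by (rule gradient_upper_quadratic[OF G up])
    finally have le: "0 \<le> g y - g x + G y \<bullet> (z - y) - G x \<bullet> (z - x) + c / 2 * (norm (z - y))\<^sup>2"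
      by simp
    have zy: "z - y = - ((1 / c) *\<^sub>R u)" and zx: "z - x = (y - x) - (1 / c) *\<^sub>R u"
      by (simp_all add: z_def)
    have "G y \<bullet> (z - y) - G x \<bullet> (z - x) = - (G x \<bullet> (y - x)) - (norm u)\<^sup>2 / c"
      unfolding zy zx inner_diff_right inner_minus_right inner_scaleR_right power2_norm_eq_inner
      by (simp add: u_def inner_diff_left inner_diff_right diff_divide_distrib)
    moreover have "c / 2 * (norm (z - y))\<^sup>2 = (norm u)\<^sup>2 / (2 * c)"
      using \<open>c > 0\<close> unfolding zy
      by (simp add: power_mult_distrib power2_eq_square field_simps)
    moreover have "(norm u)\<^sup>2 / c = (norm u)\<^sup>2 / (2 * c) + (norm u)\<^sup>2 / (2 * c)"
      by simp
    ultimately show ?thesis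
      using le unfolding u_def[symmetric] by linarith
  qed
  \<comment> \<open>Adding the gap inequality for both orders of the two points cancels the values
    of \<open>g\<close> and leaves only gradients.\<close>
  have "(norm (G y - G x))\<^sup>2 / (2 * c) + (norm (G y - G x))\<^sup>2 / (2 * c) \<le> (G y - G x) \<bullet> (y - x)"
    using gap[of y x] gap[of x y]
    by (simp add: norm_minus_commute inner_diff_left inner_diff_right)
  then show ?thesis
    using \<open>c > 0\<close> by (simp add: field_simps)
qed

text \<open>After \<open>\<eta> / 2 * (z \<bullet> z)\<close> is subtracted from \<open>g\<close>,
  the gradient is still monotone and its upper constant drops to \<open>L - \<eta>\<close>;
  cocoercivity of the remainder, expanded, is the claim. Cocoercivity needs a positive constant, so
  \<open>\<eta> = L\<close> is settled directly from the Lipschitz and strong convexity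
  bounds.\<close>

lemma smooth_strongly_convex_inner:
  fixes G :: "'a::real_inner \<Rightarrow> 'a"
  assumes G: "\<And>z. GDERIV g z :> G z"
    and lip: "\<And>y z. norm (G y - G z) \<le> L * norm (y - z)"
    and conv: "\<And>y z. (G y - G z) \<bullet> (y - z) \<ge> \<eta> * (norm (y - z))\<^sup>2"
    and "0 < \<eta>" "\<eta> \<le> L"
  shows "\<eta> * L * (norm (y - x))\<^sup>2 + (norm (G y - G x))\<^sup>2 \<le> (\<eta> + L) * ((G y - G x) \<bullet> (y - x))"
proof (cases "\<eta> = L")
  case True
  have "(norm (G y - G x))\<^sup>2 \<le> (L * norm (y - x))\<^sup>2"
    by (rule power_mono[OF lip]) simp
  then have *: "(norm (G y - G x))\<^sup>2 \<le> L * (L * (norm (y - x))\<^sup>2)"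
    by (simp add: power_mult_distrib power2_eq_square mult_ac)
  have "L * (L * (norm (y - x))\<^sup>2) \<le> L * ((G y - G x) \<bullet> (y - x))"
    using conv[of y x] True assms(4) by simp
  with * True show ?thesis
    by (simp add: algebra_simps)
next
  case False
  have *: "(norm (G y - \<eta> *\<^sub>R y - (G x - \<eta> *\<^sub>R x)))\<^sup>2
      \<le> (L - \<eta>) * ((G y - \<eta> *\<^sub>R y - (G x - \<eta> *\<^sub>R x)) \<bullet> (y - x))"
  proof (rule cocoercive)
    show "GDERIV (\<lambda>z. g z - \<eta> / 2 * (z \<bullet> z)) z :> G z - \<eta> *\<^sub>R z" for z
      using G[of z] unfolding gderiv_def
      by (auto intro!: derivative_eq_intros simp: inner_diff_right inner_commute algebra_simps)
    have eq: "(G y - \<eta> *\<^sub>R y - (G z - \<eta> *\<^sub>R z)) \<bullet> (y - z)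
        = (G y - G z) \<bullet> (y - z) - \<eta> * (norm (y - z))\<^sup>2" for y z
      by (simp add: power2_norm_eq_inner inner_diff_left inner_diff_right algebra_simps)
    show "0 \<le> (G y - \<eta> *\<^sub>R y - (G z - \<eta> *\<^sub>R z)) \<bullet> (y - z)" for y z
      using conv[of y z] by (simp add: eq)
    show "(G y - \<eta> *\<^sub>R y - (G z - \<eta> *\<^sub>R z)) \<bullet> (y - z) \<le> (L - \<eta>) * (norm (y - z))\<^sup>2" for y z
    proof -
      have "(G y - G z) \<bullet> (y - z) \<le> norm (G y - G z) * norm (y - z)"
        by (rule norm_cauchy_schwarz)
      also have "\<dots> \<le> L * norm (y - z) * norm (y - z)"
        by (rule mult_right_mono[OF lip]) simp
      finally show ?thesis
        unfolding eq left_diff_distrib by (simp add: power2_eq_square mult.assoc)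
    qed
  qed (use False assms(5) in simp)
  define u v where "u = G y - G x" and "v = y - x"
  have "G y - \<eta> *\<^sub>R y - (G x - \<eta> *\<^sub>R x) = u - \<eta> *\<^sub>R v"
    by (simp add: u_def v_def algebra_simps)
  with * have "(u - \<eta> *\<^sub>R v) \<bullet> (u - \<eta> *\<^sub>R v) \<le> (L - \<eta>) * ((u - \<eta> *\<^sub>R v) \<bullet> v)"
    by (simp add: v_def power2_norm_eq_inner)
  then have "\<eta> * L * (v \<bullet> v) + u \<bullet> u \<le> (\<eta> + L) * (u \<bullet> v)"
    by (simp add: inner_diff_left inner_diff_right inner_commute algebra_simps)
  then show ?thesis
    by (simp add: u_def v_def power2_norm_eq_inner)
qed

text \<open>Cauchy-Schwarz compares the two constants along a unit vector, which
  \<open>euclidean_space\<close> provides; in a zero space they would be unrelated.\<close>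

lemma strong_convexity_le_lipschitz:
  fixes G :: "'a::euclidean_space \<Rightarrow> 'a"
  assumes lip: "\<And>y z. norm (G y - G z) \<le> L * norm (y - z)"
    and conv: "\<And>y z. (G y - G z) \<bullet> (y - z) \<ge> \<eta> * (norm (y - z))\<^sup>2"
  shows "\<eta> \<le> L"
proof -
  obtain b :: 'a where b: "b \<in> Basis"
    using nonempty_Basis by blast
  have "\<eta> \<le> (G b - G 0) \<bullet> b"
    using conv[of b 0] b by simp
  also have "\<dots> \<le> norm (G b - G 0) * norm b"
    by (rule norm_cauchy_schwarz)
  also have "\<dots> \<le> L"
    using lip[of b 0] b by simp
  finally show ?thesis .
qed

text \<open>In the expanded square, the inner product is bounded by
  \<open>smooth_strongly_convex_inner\<close>. The condition \<alpha> \<le> 2 / (\<eta> + L) is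
  exactly what lets the resulting negative multiple of \<open>(norm (G y))\<^sup>2\<close> absorb
  the term with \<open>\<alpha>\<^sup>2\<close>.\<close>

lemma gradient_step_contraction:
  fixes G :: "'a::real_inner \<Rightarrow> 'a"
  assumes "\<And>z. GDERIV g z :> G z"
    and "\<And>y z. norm (G y - G z) \<le> L * norm (y - z)"
    and "\<And>y z. (G y - G z) \<bullet> (y - z) \<ge> \<eta> * (norm (y - z))\<^sup>2"
    and "0 < \<eta>" "\<eta> \<le> L" "0 < \<alpha>" "\<alpha> \<le> 2 / (\<eta> + L)"
    and "G x = 0"
  shows "(norm (y - x - \<alpha> *\<^sub>R G y))\<^sup>2 \<le> contraction \<alpha> \<eta> L * (norm (y - x))\<^sup>2"
proof -
  define s where "s = \<eta> + L"
  have s: "s > 0" using assms by (simp add: s_def)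
  have "\<eta> * L * (norm (y - x))\<^sup>2 + (norm (G y))\<^sup>2 \<le> s * (G y \<bullet> (y - x))"
    using smooth_strongly_convex_inner[OF assms(1-5), of y x] assms(8) by (simp add: s_def)
  then have "2 * \<alpha> * ((\<eta> * L * (norm (y - x))\<^sup>2 + (norm (G y))\<^sup>2) / s) \<le> 2 * \<alpha> * (G y \<bullet> (y - x))"
    using s assms(6) by (intro mult_left_mono) (simp_all add: field_simps)
  moreover have "\<alpha>\<^sup>2 * (norm (G y))\<^sup>2 \<le> \<alpha> * (2 / s) * (norm (G y))\<^sup>2"
    unfolding power2_eq_square[of \<alpha>] using assms(6,7)
    by (intro mult_right_mono mult_left_mono) (simp_all add: s_def)
  moreover have "(norm (y - x - \<alpha> *\<^sub>R G y))\<^sup>2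
      = (norm (y - x))\<^sup>2 - 2 * \<alpha> * (G y \<bullet> (y - x)) + \<alpha>\<^sup>2 * (norm (G y))\<^sup>2"
    unfolding power2_norm_eq_inner
    by (simp add: inner_diff_left inner_diff_right inner_commute power2_eq_square algebra_simps)
  moreover have "2 * \<alpha> * ((\<eta> * L * (norm (y - x))\<^sup>2 + (norm (G y))\<^sup>2) / s)
      = (1 - contraction \<alpha> \<eta> L) * (norm (y - x))\<^sup>2 + \<alpha> * (2 / s) * (norm (G y))\<^sup>2"
    by (simp add: contraction_def s_def add_divide_distrib algebra_simps)
  ultimately show ?thesis
    by (simp add: algebra_simps)
qed

text \<open>At the largest admissible step the subtracted term is
  \<open>4 * \<eta> * L / (\<eta> + L)\<^sup>2\<close>, at most 1 because
  \<open>(L - \<eta>)\<^sup>2\<close> is nonnegative. Nonnegativity of q later allows the error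
  recursion to be iterated and makes \<rho> positive.\<close>

lemma contraction_bounds:
  assumes "0 < \<eta>" "\<eta> \<le> L" "0 < \<alpha>" "\<alpha> \<le> 2 / (\<eta> + L)"
  shows "0 \<le> contraction \<alpha> \<eta> L" "contraction \<alpha> \<eta> L < 1"
proof -
  have "2 * \<alpha> * \<eta> * L / (\<eta> + L) \<le> 2 * (2 / (\<eta> + L)) * \<eta> * L / (\<eta> + L)"
    using assms by (intro divide_right_mono mult_right_mono mult_left_mono) auto
  also have "\<dots> = 4 * \<eta> * L / (\<eta> + L)\<^sup>2"
    by (simp add: power2_eq_square)
  also have "\<dots> \<le> 1"
    using assms zero_le_power2[of "L - \<eta>"]
    by (simp add: power2_sum power2_diff add_nonneg_pos)
  finally show "0 \<le> contraction \<alpha> \<eta> L"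
    by (simp add: contraction_def)
  show "contraction \<alpha> \<eta> L < 1"
    using assms by (simp add: contraction_def)
qed

section \<open>Measurability and independence\<close>

text \<open>Each coordinate of the gradient is a pointwise limit of difference quotients with steps
  1 / (n + 1), and these are jointly measurable in point and sample.\<close>

lemma borel_measurable_grad:
  fixes F :: "'a::euclidean_space \<Rightarrow> 's \<Rightarrow> real"
  assumes F: "case_prod F \<in> borel_measurable (borel \<Otimes>\<^sub>M S)"
    and diff: "\<And>y s. (\<lambda>z. F z s) differentiable (at y)"
  shows "(\<lambda>(y, s). grad (\<lambda>z. F z s) y) \<in> borel_measurable (borel \<Otimes>\<^sub>M S)"
proof (rule borel_measurable_euclidean_space[THEN iffD2], rule ballI)
  fix b :: 'a assume "b \<in> Basis"
  define u where "u n p = (F (fst p + inverse (real (Suc n)) *\<^sub>R b) (snd p) - F (fst p) (snd p))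
      / inverse (real (Suc n))" for n p
  have "(\<lambda>n. u n p) \<longlonglongrightarrow> (case p of (y, s) \<Rightarrow> grad (\<lambda>z. F z s) y) \<bullet> b" for p
  proof -
    have lim: "((\<lambda>h. (F (fst p + h *\<^sub>R b) (snd p) - F (fst p) (snd p)) / h)
        \<longlongrightarrow> grad (\<lambda>z. F z (snd p)) (fst p) \<bullet> b) (at 0)"
      using gderiv_line[of "\<lambda>z. F z (snd p)" "grad (\<lambda>z. F z (snd p))" "fst p" b 0,
          OF gderiv_grad[OF diff]]
      by (simp add: DERIV_def)
    have "filterlim (\<lambda>n. inverse (real (Suc n))) (at 0) sequentially"
      by (rule filterlim_atI[OF LIMSEQ_inverse_real_of_nat]) simp
    from filterlim_compose[OF lim this] show ?thesis
      unfolding u_def case_prod_beta .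
  qed
  moreover have "u n \<in> borel_measurable (borel \<Otimes>\<^sub>M S)" for n
  proof -
    have "(\<lambda>p. case_prod F (fst p + inverse (real (Suc n)) *\<^sub>R b, snd p))
        \<in> borel_measurable (borel \<Otimes>\<^sub>M S)"
      by (rule measurable_compose[OF _ F]) measurable
    moreover have "(\<lambda>p. case_prod F (fst p, snd p)) \<in> borel_measurable (borel \<Otimes>\<^sub>M S)"
      using F by simp
    ultimately show ?thesis
      unfolding u_def by simp
  qed
  ultimately show "(\<lambda>p. (case p of (y, s) \<Rightarrow> grad (\<lambda>z. F z s) y) \<bullet> b)
      \<in> borel_measurable (borel \<Otimes>\<^sub>M S)"
    by (rule borel_measurable_LIMSEQ_real[where u = u])
qed

section \<open>Square-integrable random vectors and tools for independence\<close>

lemma integrable_inner_square_integrable: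
  fixes f g :: "'w \<Rightarrow> 'a::euclidean_space"
  assumes [measurable]: "f \<in> borel_measurable M" "g \<in> borel_measurable M"
    and "integrable M (\<lambda>\<omega>. (norm (f \<omega>))\<^sup>2)" "integrable M (\<lambda>\<omega>. (norm (g \<omega>))\<^sup>2)"
  shows "integrable M (\<lambda>\<omega>. f \<omega> \<bullet> g \<omega>)"
proof (rule Bochner_Integration.integrable_bound)
  show "integrable M (\<lambda>\<omega>. (norm (f \<omega>))\<^sup>2 + (norm (g \<omega>))\<^sup>2)"
    using assms by simp
  have "\<bar>x \<bullet> y\<bar> \<le> \<bar>(norm x)\<^sup>2 + (norm y)\<^sup>2\<bar>" for x y :: 'a
  proof -
    have "\<bar>x \<bullet> y\<bar> \<le> norm x * norm y"
      by (rule Cauchy_Schwarz_ineq2)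
    also have "\<dots> \<le> (norm x)\<^sup>2 + (norm y)\<^sup>2"
      using sum_squares_bound[of "norm x" "norm y"]
        mult_nonneg_nonneg[OF norm_ge_zero[of x] norm_ge_zero[of y]] by linarith
    finally show ?thesis by simp
  qed
  then show "AE \<omega> in M. norm (f \<omega> \<bullet> g \<omega>) \<le> norm ((norm (f \<omega>))\<^sup>2 + (norm (g \<omega>))\<^sup>2)"
    by simp
qed simp

lemma square_integrable_add:
  fixes f g :: "'w \<Rightarrow> 'a::euclidean_space"
  assumes [measurable]: "f \<in> borel_measurable M" "g \<in> borel_measurable M"
    and "integrable M (\<lambda>\<omega>. (norm (f \<omega>))\<^sup>2)" "integrable M (\<lambda>\<omega>. (norm (g \<omega>))\<^sup>2)"
  shows "integrable M (\<lambda>\<omega>. (norm (f \<omega> + g \<omega>))\<^sup>2)"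
proof -
  have "integrable M (\<lambda>\<omega>. (norm (f \<omega>))\<^sup>2 + (norm (g \<omega>))\<^sup>2 + 2 * (f \<omega> \<bullet> g \<omega>))"
    using assms(3,4) integrable_inner_square_integrable[OF assms] by simp
  moreover have "(norm (x + y))\<^sup>2 = (norm x)\<^sup>2 + (norm y)\<^sup>2 + 2 * (x \<bullet> y)" for x y :: 'a
    by (simp add: power2_norm_eq_inner inner_add_left inner_add_right inner_commute)
  ultimately show ?thesis by simp
qed

lemma square_integrable_component:
  fixes f :: "'w \<Rightarrow> real ^ 'm"
  assumes [measurable]: "f \<in> borel_measurable M" and "integrable M (\<lambda>\<omega>. (norm (f \<omega>))\<^sup>2)"
  shows "integrable M (\<lambda>\<omega>. (f \<omega> $ i)\<^sup>2)"
proof (rule Bochner_Integration.integrable_bound[OF assms(2)])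
  show "AE \<omega> in M. norm ((f \<omega> $ i)\<^sup>2) \<le> norm ((norm (f \<omega>))\<^sup>2)"
    using component_le_norm_cart[of "f _" i] by (simp add: abs_le_square_iff[symmetric])
  show "(\<lambda>\<omega>. (f \<omega> $ i)\<^sup>2) \<in> borel_measurable M"
    using measurable_compose[OF assms(1) borel_measurable_nth] by (rule borel_measurable_power)
qed

text \<open>Merges the initial point, placed at index \<open>None\<close>, with the samples into one
  independent family. In a finite intersection the sample part lies in the sigma-algebra they
  generate, so the factor at \<open>None\<close> splits off first and the rest factorizes by
  \<open>E\<close>.\<close>

lemma (in prob_space) indep_sets_case_option:
  assumes E: "indep_sets E I"
    and A: "indep_set A (sigma_sets (space M) (\<Union>i\<in>I. E i))"
  shows "indep_sets (case_option A E) (insert None (Some ` I))"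
proof (rule indep_setsI)
  fix i assume "i \<in> insert None (Some ` I)"
  then show "case_option A E i \<subseteq> events"
    using E[unfolded indep_sets_def] indep_setD_ev1[OF A] by (cases i) auto
next
  fix B J assume J: "J \<noteq> {}" "J \<subseteq> insert None (Some ` I)" "finite J"
    and B: "\<forall>j\<in>J. B j \<in> (case j of None \<Rightarrow> A | Some x \<Rightarrow> E x)"
  define K where "K = Some -` J"
  have K: "finite K" "K \<subseteq> I" "\<And>i. i \<in> K \<Longrightarrow> B (Some i) \<in> E i"
    using J B by (auto simp: K_def intro!: finite_vimageI)
  have prod_K: "prob (\<Inter>i\<in>K. B (Some i)) = (\<Prod>i\<in>K. prob (B (Some i)))" if "K \<noteq> {}"
    using indep_setsD[OF E K(2) that K(1), of "\<lambda>i. B (Some i)"] K(3) by blast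
  show "prob (\<Inter>j\<in>J. B j) = (\<Prod>j\<in>J. prob (B j))"
  proof (cases "None \<in> J")
    case False
    then have "J = Some ` K"
      using J(2) by (auto simp: K_def)
    with J(1) prod_K show ?thesis
      by (simp add: prod.reindex)
  next
    case True
    then have J_eq: "J = insert None (Some ` K)"
      using J(2) by (auto simp: K_def)
    show ?thesis
    proof (cases "K = {}")
      case False
      have "(\<Union>i\<in>I. E i) \<subseteq> Pow (space M)"
        using E[unfolded indep_sets_def] sets.sets_into_space by blast
      then interpret S: sigma_algebra "space M" "sigma_sets (space M) (\<Union>i\<in>I. E i)"
        by (rule sigma_algebra_sigma_sets)
      have "(\<Inter>i\<in>K. B (Some i)) \<in> sigma_sets (space M) (\<Union>i\<in>I. E i)"
        using K False by (intro S.finite_INT) (auto intro: sigma_sets.Basic)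
      then have "prob (B None \<inter> (\<Inter>i\<in>K. B (Some i))) = prob (B None) * prob (\<Inter>i\<in>K. B (Some i))"
        using B True by (intro indep_setD[OF A]) force+
      then show ?thesis
        using K(1) prod_K[OF False] by (simp add: J_eq prod.reindex)
    qed (simp add: J_eq)
  qed
qed

text \<open>Independence makes the joint law of \<open>U\<close> and \<open>V\<close> a product
  measure, so Fubini integrates \<open>V\<close> out with the value of \<open>U\<close>
  frozen.\<close>

lemma (in prob_space) expectation_indep_var_fubini:
  fixes h :: "_ \<Rightarrow> _ \<Rightarrow> real"
  assumes indep: "indep_var S U T V"
    and h: "case_prod h \<in> borel_measurable (S \<Otimes>\<^sub>M T)"
    and int: "integrable M (\<lambda>\<omega>. h (U \<omega>) (V \<omega>))"
  shows "integrable M (\<lambda>\<omega>. expectation (\<lambda>\<omega>'. h (U \<omega>) (V \<omega>')))"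
    and "expectation (\<lambda>\<omega>. h (U \<omega>) (V \<omega>)) = expectation (\<lambda>\<omega>. expectation (\<lambda>\<omega>'. h (U \<omega>) (V \<omega>')))"
proof -
  have [measurable]: "U \<in> measurable M S" "V \<in> measurable M T"
    and eq: "distr M S U \<Otimes>\<^sub>M distr M T V = distr M (S \<Otimes>\<^sub>M T) (\<lambda>\<omega>. (U \<omega>, V \<omega>))"
    using indep unfolding indep_var_distribution_eq by auto
  interpret U: prob_space "distr M S U" by (rule prob_space_distr) simp
  interpret V: prob_space "distr M T V" by (rule prob_space_distr) simp
  interpret UV: pair_prob_space "distr M S U" "distr M T V" ..
  note [measurable] = h
  have inner: "(\<integral>t. h s t \<partial>distr M T V) = expectation (\<lambda>\<omega>'. h s (V \<omega>'))" if "s \<in> space S" for s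
    using that by (subst integral_distr) simp_all
  have int': "integrable (distr M S U \<Otimes>\<^sub>M distr M T V) (case_prod h)"
    using int by (simp add: eq integrable_distr_eq)
  have m: "(\<lambda>s. \<integral>t. h s t \<partial>distr M T V) \<in> borel_measurable S"
    using V.borel_measurable_lebesgue_integral[of h S] by simp
  have U_space: "U \<omega> \<in> space S" if "\<omega> \<in> space M" for \<omega>
    using measurable_space[OF \<open>U \<in> measurable M S\<close> that] .
  have cong: "integrable M (\<lambda>\<omega>. \<integral>t. h (U \<omega>) t \<partial>distr M T V)
      = integrable M (\<lambda>\<omega>. expectation (\<lambda>\<omega>'. h (U \<omega>) (V \<omega>')))"
    by (rule Bochner_Integration.integrable_cong) (simp_all add: inner U_space)
  show "integrable M (\<lambda>\<omega>. expectation (\<lambda>\<omega>'. h (U \<omega>) (V \<omega>')))"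
    using UV.integrable_fst[OF int'] m by (simp add: integrable_distr_eq cong)
  have "expectation (\<lambda>\<omega>. h (U \<omega>) (V \<omega>)) = integral\<^sup>L (distr M S U \<Otimes>\<^sub>M distr M T V) (case_prod h)"
    by (simp add: eq integral_distr)
  also have "\<dots> = (\<integral>s. (\<integral>t. h s t \<partial>distr M T V) \<partial>distr M S U)"
    using UV.integral_fst[OF int'] by simp
  also have "\<dots> = expectation (\<lambda>\<omega>. \<integral>t. h (U \<omega>) t \<partial>distr M T V)"
    using m by (simp add: integral_distr)
  also have "\<dots> = expectation (\<lambda>\<omega>. expectation (\<lambda>\<omega>'. h (U \<omega>) (V \<omega>')))"
    by (rule Bochner_Integration.integral_cong) (simp_all add: inner U_space)
  finally show "expectation (\<lambda>\<omega>. h (U \<omega>) (V \<omega>))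
      = expectation (\<lambda>\<omega>. expectation (\<lambda>\<omega>'. h (U \<omega>) (V \<omega>')))" .
qed

text \<open>Keeping point and sample as separate arguments allows a fresh sample to be integrated
  out at a frozen point.\<close>

definition noise ::
    "('a::real_inner \<Rightarrow> 'b \<Rightarrow> real) \<Rightarrow> ('a \<Rightarrow> real) \<Rightarrow> 'a \<Rightarrow> 'b \<Rightarrow> 'a" where
  "noise F f y s = grad (\<lambda>z. F z s) y - grad f y"

lemma batch_error_eq_noise_average:
  assumes "0 < n"
  shows "batch_error F f n s y = (1 / real n) *\<^sub>R (\<Sum>j = 1..n. noise F f y (s j))"
  using assms
  by (simp add: batch_error_def noise_def sum_subtractf scaleR_diff_right sum_constant_scaleR)

lemma Int_stable_vimage: "Int_stable {g -` A \<inter> S | A. A \<in> sets N}"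
proof (rule Int_stableI)
  fix a b assume "a \<in> {g -` A \<inter> S | A. A \<in> sets N}" "b \<in> {g -` A \<inter> S | A. A \<in> sets N}"
  then obtain A B where "a = g -` A \<inter> S" "b = g -` B \<inter> S" "A \<in> sets N" "B \<in> sets N"
    by auto
  then show "a \<inter> b \<in> {g -` A \<inter> S | A. A \<in> sets N}"
    by (auto intro!: exI[of _ "A \<inter> B"])
qed

section \<open>The filtration of histories and adaptedness of the iterates\<close>

context batch_sgd
begin

abbreviation past :: "nat \<Rightarrow> 'w measure" where
  "past \<equiv> history M (X 0) \<xi>s N"

definition sample_sets :: "nat \<times> nat \<Rightarrow> 'w set set" where
  "sample_sets = (\<lambda>(j, k). {\<xi>s j k -` A \<inter> space M | A. A \<in> sets borel})"

definition init_sets :: "'w set set" where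
  "init_sets = {X 0 -` A \<inter> space M | A. A \<in> sets borel}"

text \<open>With \<open>None\<close> for the initial point and \<open>Some (j, k)\<close> for a
  sample, all randomness forms one indexed family, and a history and a fresh sample correspond to
  disjoint index sets.\<close>

definition source_sets :: "(nat \<times> nat) option \<Rightarrow> 'w set set" where
  "source_sets = case_option init_sets sample_sets"

definition past_index :: "nat \<Rightarrow> (nat \<times> nat) option set" where
  "past_index k = insert None (Some ` {p \<in> sample_index N. snd p < k})"

lemma batch_index: "j \<in> {1..N k} \<longleftrightarrow> (j, k) \<in> sample_index N"
  by (auto simp: sample_index_def)

lemma sample_measurable:
  "(j, k) \<in> sample_index N \<Longrightarrow> \<xi>s j k \<in> borel_measurable M"
  using samples_indep unfolding indep_vars_def2 by fastforce

lemma source_sets_events: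
  assumes "i \<in> insert None (Some ` sample_index N)"
  shows "source_sets i \<subseteq> events"
proof (cases i)
  case None
  then show ?thesis
    using measurable_sets[OF init_measurable] by (auto simp: source_sets_def init_sets_def)
next
  case (Some p)
  obtain j k where "p = (j, k)"
    by (cases p)
  with assms Some show ?thesis
    using measurable_sets[OF sample_measurable, of j k]
    by (auto simp: source_sets_def sample_sets_def)
qed

lemma past_generators:
  "{X 0 -` A \<inter> space M | A. A \<in> sets borel} \<union>
      {\<xi>s j t -` A \<inter> space M | j t A. t < k \<and> (j, t) \<in> sample_index N \<and> A \<in> sets borel}
    = (\<Union>i\<in>past_index k. source_sets i)"
  unfolding past_index_def source_sets_def init_sets_def sample_sets_def by fastforce

lemma past_index_subset: "past_index k \<subseteq> insert None (Some ` sample_index N)"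
  by (auto simp: past_index_def)

lemma past_sources_events: "(\<Union>i\<in>past_index k. source_sets i) \<subseteq> events"
  using source_sets_events past_index_subset by blast

lemma past_sources_Pow: "(\<Union>i\<in>past_index k. source_sets i) \<subseteq> Pow (space M)"
  using past_sources_events sets.sets_into_space by blast

lemma space_past: "space (past k) = space M"
  unfolding history_def by (rule space_measure_of) (simp add: past_generators past_sources_Pow)

lemma sets_past: "sets (past k) = sigma_sets (space M) (\<Union>i\<in>past_index k. source_sets i)"
  unfolding history_def past_generators by (rule sets_measure_of) (rule past_sources_Pow)

lemma subalgebra_past: "subalgebra M (past k)"
  unfolding subalgebra_def space_past sets_past
  using sets.sigma_sets_subset[OF past_sources_events] by simp

lemma sigma_finite_subalgebra_past: "sigma_finite_subalgebra M (past k)"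
  by (rule finite_measure_subalgebra_is_sigma_finite)
    (simp add: finite_measure_subalgebra_def finite_measure_subalgebra_axioms_def
      finite_measure_axioms subalgebra_past)

lemma subalgebra_past_mono:
  assumes "k \<le> l"
  shows "subalgebra (past l) (past k)"
  unfolding subalgebra_def space_past sets_past
  using assms by (auto intro!: sigma_sets_mono' simp: past_index_def)

lemma init_past_measurable: "X 0 \<in> borel_measurable (past k)"
proof (rule measurableI)
  fix A :: "(real ^ 'm) set" assume "A \<in> sets borel"
  then have "X 0 -` A \<inter> space M \<in> (\<Union>i\<in>past_index k. source_sets i)"
    by (auto simp: past_index_def source_sets_def init_sets_def)
  then show "X 0 -` A \<inter> space (past k) \<in> sets (past k)"
    unfolding sets_past space_past by (rule sigma_sets.Basic)
qed simp

lemma sample_past_measurable: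
  assumes "(j, t) \<in> sample_index N" "t < k"
  shows "\<xi>s j t \<in> borel_measurable (past k)"
proof (rule measurableI)
  fix A :: "(real ^ 'd) set" assume "A \<in> sets borel"
  then have "\<xi>s j t -` A \<inter> space M \<in> source_sets (Some (j, t))"
    by (auto simp: source_sets_def sample_sets_def)
  moreover have "Some (j, t) \<in> past_index k"
    using assms by (auto simp: past_index_def)
  ultimately show "\<xi>s j t -` A \<inter> space (past k) \<in> sets (past k)"
    unfolding sets_past space_past by (blast intro: sigma_sets.Basic)
qed simp

lemma grad_f_measurable [measurable]: "grad f \<in> borel_measurable borel"
  using grad_f_continuous by (rule borel_measurable_continuous_onI)

lemma noise_measurable: "case_prod (noise F f) \<in> borel_measurable (borel \<Otimes>\<^sub>M borel)"
proof -
  have [measurable]: "(\<lambda>(y, s). grad (\<lambda>z. F z s) y) \<in> borel_measurable (borel \<Otimes>\<^sub>M borel)"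
    using F_measurable F_differentiable by (rule borel_measurable_grad)
  have "(\<lambda>p. (case p of (y, s) \<Rightarrow> grad (\<lambda>z. F z s) y) - grad f (fst p))
      \<in> borel_measurable (borel \<Otimes>\<^sub>M borel)"
    by measurable
  then show ?thesis
    by (simp add: noise_def case_prod_beta')
qed

lemma noise_compose_measurable:
  assumes "U \<in> borel_measurable K" "V \<in> borel_measurable K"
  shows "(\<lambda>\<omega>. noise F f (U \<omega>) (V \<omega>)) \<in> borel_measurable K"
  using measurable_compose[OF measurable_Pair[OF assms] noise_measurable] by simp

text \<open>Iterate \<open>Suc k\<close> is a measurable function of iterate \<open>k\<close> and
  batch \<open>k\<close>, and batch \<open>k\<close> belongs to the history at
  \<open>Suc k\<close>.\<close>

lemma X_past_measurable: "X k \<in> borel_measurable (past k)"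
proof (induction k)
  case 0
  show ?case by (rule init_past_measurable)
next
  case (Suc k)
  have X [measurable]: "X k \<in> borel_measurable (past (Suc k))"
    using measurable_from_subalg[OF subalgebra_past_mono Suc] by simp
  have [measurable]: "(\<lambda>\<omega>. noise F f (X k \<omega>) (\<xi>s j k \<omega>)) \<in> borel_measurable (past (Suc k))"
    if "j \<in> {1..N k}" for j
    using that X by (intro noise_compose_measurable sample_past_measurable) (auto simp: sample_index_def)
  have "(\<lambda>\<omega>. X k \<omega> - \<alpha> *\<^sub>R (grad f (X k \<omega>)
      + (1 / real (N k)) *\<^sub>R (\<Sum>j = 1..N k. noise F f (X k \<omega>) (\<xi>s j k \<omega>))))
    \<in> borel_measurable (past (Suc k))"
    by measurable
  \<comment> \<open>The recursion is assumed only on \<open>space M\<close>, so the update formula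
    enters through \<open>measurable_cong\<close> instead of an equality of functions.\<close>
  then show ?case
    by (rule measurable_cong[THEN iffD1, rotated])
      (simp add: X_Suc batch_error_eq_noise_average[OF N_pos] space_past)
qed

lemma X_measurable [measurable]: "X k \<in> borel_measurable M"
  using measurable_from_subalg[OF subalgebra_past X_past_measurable] .

abbreviation sample_noise :: "nat \<Rightarrow> nat \<Rightarrow> 'w \<Rightarrow> real ^ 'm" where
  "sample_noise j k \<omega> \<equiv> noise F f (X k \<omega>) (\<xi>s j k \<omega>)"

lemma sample_noise_measurable:
  "(j, k) \<in> sample_index N \<Longrightarrow> sample_noise j k \<in> borel_measurable M"
  by (rule noise_compose_measurable[OF X_measurable sample_measurable])

section \<open>Independence of the iterate and the samples of its batch\<close>

lemma indep_sources: "indep_sets source_sets (insert None (Some ` sample_index N))"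
  unfolding source_sets_def
proof (rule indep_sets_case_option)
  have "indep_sets (\<lambda>i. {(case i of (j, k) \<Rightarrow> \<xi>s j k) -` A \<inter> space M | A. A \<in> sets borel})
      (sample_index N)"
    using samples_indep unfolding indep_vars_def2 by simp
  moreover have "(\<lambda>i. {(case i of (j, k) \<Rightarrow> \<xi>s j k) -` A \<inter> space M | A. A \<in> sets borel})
      = sample_sets"
    by (auto simp: sample_sets_def fun_eq_iff)
  ultimately show "indep_sets sample_sets (sample_index N)"
    by simp
  have "init_sets = sets (vimage_algebra (space M) (X 0) borel)"
    by (auto simp: init_sets_def sets_vimage_algebra2)
  moreover have "{\<xi>s j k -` A \<inter> space M | j k A. (j, k) \<in> sample_index N \<and> A \<in> sets borel}
      = (\<Union>i\<in>sample_index N. sample_sets i)"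
    unfolding sample_sets_def by fastforce
  ultimately show "indep_set init_sets (sigma_sets (space M) (\<Union>i\<in>sample_index N. sample_sets i))"
    using init_indep by simp
qed

lemma Int_stable_source_sets: "Int_stable (source_sets i)"
  by (auto simp: source_sets_def init_sets_def sample_sets_def Int_stable_vimage
      split: option.split)

text \<open>
  The library relation \<open>indep_var\<close> wants both variables to have the same type, hence the dummy first
  component of the second one.
\<close>

lemma indep_iterate_samples:
  assumes i: "(i, k) \<in> sample_index N" and j: "(j, k) \<in> sample_index N" and "i \<noteq> j"
  shows "indep_var (borel \<Otimes>\<^sub>M borel) (\<lambda>\<omega>. (X k \<omega>, \<xi>s i k \<omega>))
      (borel \<Otimes>\<^sub>M borel) (\<lambda>\<omega>. (0, \<xi>s j k \<omega>))"
proof -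
  define V :: "'w \<Rightarrow> (real ^ 'm) \<times> (real ^ 'd)" where "V = (\<lambda>\<omega>. (0, \<xi>s j k \<omega>))"
  \<comment> \<open>Two disjoint blocks of sources: the history with sample \<open>i\<close>, and
    sample \<open>j\<close> alone. The sigma-algebras they generate are independent, and the first
    makes \<open>X k\<close> and sample \<open>i\<close> measurable.\<close>
  define I where "I = case_bool (insert (Some (i, k)) (past_index k)) {Some (j, k)}"
  have I: "indep_sets (\<lambda>b. sigma_sets (space M) (\<Union>i\<in>I b. source_sets i)) UNIV"
  proof (rule indep_sets_collect_sigma)
    show "indep_sets source_sets (\<Union>b\<in>UNIV. I b)"
      using i j past_index_subset
      by (intro indep_sets_mono_index[OF _ indep_sources]) (auto simp: I_def UNIV_bool)
    show "disjoint_family_on I UNIV"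
      using \<open>i \<noteq> j\<close> by (auto simp: disjoint_family_on_def I_def past_index_def split: bool.split)
  qed (rule Int_stable_source_sets)
  have I_eq: "(\<lambda>b. sigma_sets (space M) (\<Union>i\<in>I b. source_sets i))
      = case_bool (sigma_sets (space M) (\<Union>i\<in>I True. source_sets i))
          (sigma_sets (space M) (source_sets (Some (j, k))))"
    by (rule ext) (simp add: I_def split: bool.split)
  have indep: "indep_set (sigma_sets (space M) (\<Union>i\<in>I True. source_sets i))
      (sigma_sets (space M) (source_sets (Some (j, k))))"
    unfolding indep_set_def I_eq[symmetric] by (rule I)
  define K where "K = sigma (space M) (\<Union>i\<in>I True. source_sets i)"
  have gen: "(\<Union>i\<in>I True. source_sets i) \<subseteq> Pow (space M)"
  proof -
    have "source_sets (Some (i, k)) \<subseteq> Pow (space M)"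
      using source_sets_events[of "Some (i, k)"] i sets.sets_into_space by blast
    then show ?thesis
      using past_sources_Pow[of k] by (simp add: I_def)
  qed
  have space_K: "space K = space M" and sets_K: "sets K = sigma_sets (space M) (\<Union>i\<in>I True. source_sets i)"
    using gen by (simp_all add: K_def space_measure_of sets_measure_of)
  have "subalgebra K (past k)"
    unfolding subalgebra_def space_past sets_past space_K sets_K
    by (auto intro!: sigma_sets_mono' simp: I_def)
  then have [measurable]: "X k \<in> borel_measurable K"
    by (rule measurable_from_subalg[OF _ X_past_measurable])
  have [measurable]: "\<xi>s i k \<in> borel_measurable K"
  proof (rule measurableI)
    fix A :: "(real ^ 'd) set" assume "A \<in> sets borel"
    then have "\<xi>s i k -` A \<inter> space M \<in> source_sets (Some (i, k))"
      by (auto simp: source_sets_def sample_sets_def)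
    then show "\<xi>s i k -` A \<inter> space K \<in> sets K"
      unfolding sets_K space_K by (intro sigma_sets.Basic) (auto simp: I_def)
  qed simp
  have pair: "(\<lambda>\<omega>. (X k \<omega>, \<xi>s i k \<omega>)) \<in> measurable K (borel \<Otimes>\<^sub>M borel)"
    by measurable
  have pair_sets: "sigma_sets (space M) {(\<lambda>\<omega>. (X k \<omega>, \<xi>s i k \<omega>)) -` A \<inter> space M | A. A \<in> sets (borel \<Otimes>\<^sub>M borel)}
      \<subseteq> sets K"
    unfolding space_K[symmetric]
    by (rule sets.sigma_sets_subset) (auto intro: measurable_sets[OF pair])
  have V_sets: "sigma_sets (space M) {V -` A \<inter> space M | A. A \<in> sets (borel \<Otimes>\<^sub>M borel)}
      \<subseteq> sigma_sets (space M) (source_sets (Some (j, k)))"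
  proof (rule sigma_sets_mono', safe)
    fix A :: "((real ^ 'm) \<times> (real ^ 'd)) set" assume A: "A \<in> sets (borel \<Otimes>\<^sub>M borel)"
    have "Pair 0 -` A \<in> sets borel"
      using measurable_sets[OF measurable_Pair1' A, of 0] by simp
    moreover have "V -` A \<inter> space M = \<xi>s j k -` (Pair 0 -` A) \<inter> space M"
      by (auto simp: V_def)
    ultimately show "V -` A \<inter> space M \<in> source_sets (Some (j, k))"
      by (auto simp: source_sets_def sample_sets_def)
  qed
  have "indep_set
      (sigma_sets (space M) {(\<lambda>\<omega>. (X k \<omega>, \<xi>s i k \<omega>)) -` A \<inter> space M | A. A \<in> sets (borel \<Otimes>\<^sub>M borel)})
      (sigma_sets (space M) {V -` A \<inter> space M | A. A \<in> sets (borel \<Otimes>\<^sub>M borel)})"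
    unfolding indep_set_def
    by (rule indep_sets_mono_sets[OF indep[unfolded indep_set_def]])
      (use pair_sets V_sets in \<open>simp add: sets_K split: bool.splits\<close>)
  then show ?thesis
    unfolding indep_var_eq V_def using sample_measurable[OF i] sample_measurable[OF j] by auto
qed

end

section \<open>Linear convergence and its complexity\<close>

text \<open>The perturbation decays at rate \<rho> while the contraction is strictly faster, so the
  accumulated perturbations form a convergent geometric series in \<open>q / \<rho>\<close>, at the
  common rate \<rho>.\<close>

lemma perturbed_contraction_bound:
  fixes e :: "nat \<Rightarrow> real"
  assumes "\<And>k. e (Suc k) \<le> q * e k + s * \<rho> ^ Suc k"
    and "0 \<le> q" "q < \<rho>" "0 \<le> s" "0 \<le> e 0"
  shows "e k \<le> \<rho> ^ k * (e 0 + s / (1 - q / \<rho>))"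
proof (induction k)
  case 0
  show ?case using assms by simp
next
  case (Suc k)
  \<comment> \<open>\<open>r\<close> is the sum of that series;
    \<open>q * r + \<rho> = \<rho> * r\<close> says that the noise part reproduces itself exactly in
    the induction step.\<close>
  define r where "r = 1 / (1 - q / \<rho>)"
  have r: "q * r + \<rho> = \<rho> * r"
    using assms by (simp add: r_def field_simps)
  have "e (Suc k) \<le> q * e k + s * \<rho> ^ Suc k"
    by (rule assms(1))
  also have "\<dots> \<le> q * (\<rho> ^ k * (e 0 + s * r)) + s * \<rho> ^ Suc k"
    using Suc assms(2) by (intro add_right_mono mult_left_mono) (simp_all add: r_def)
  also have "\<dots> = \<rho> ^ k * (q * e 0 + s * (q * r + \<rho>))"
    by (simp add: algebra_simps)
  also have "\<dots> \<le> \<rho> ^ k * (\<rho> * e 0 + s * (q * r + \<rho>))"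
    using assms by (intro mult_left_mono add_right_mono mult_right_mono) auto
  also have "\<dots> = \<rho> ^ Suc k * (e 0 + s * r)"
    unfolding r by (simp add: algebra_simps)
  finally show ?case
    by (simp add: r_def)
qed

text \<open>From \<rho> \<le> exp (\<rho> - 1), about ln (B / \<epsilon>) / (1 - \<rho>) steps
  suffice, and the extra 1 is for rounding up. The form with \<open>1 - \<rho>\<close> is chosen
  because that gap is what compares with \<open>\<eta> / L\<close>.\<close>

lemma geometric_first_hit:
  fixes e :: "nat \<Rightarrow> real"
  assumes e: "\<And>k. e k \<le> \<rho> ^ k * B" and \<rho>: "0 < \<rho>" "\<rho> < 1" and "0 < \<epsilon>" "\<epsilon> \<le> B"
  shows "\<exists>k. e k \<le> \<epsilon>" and "real (LEAST k. e k \<le> \<epsilon>) \<le> ln (B / \<epsilon>) / (1 - \<rho>) + 1"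
proof -
  define x where "x = ln (B / \<epsilon>) / (1 - \<rho>)"
  define k where "k = nat \<lceil>x\<rceil>"
  have B: "B > 0" using assms by simp
  have x: "x \<ge> 0"
    using assms B by (simp add: x_def)
  then have k: "x \<le> real k" "real k \<le> x + 1"
    unfolding k_def by linarith+
  have "\<rho> ^ k \<le> exp (\<rho> - 1) ^ k"
    using exp_ge_add_one_self[of "\<rho> - 1"] \<rho> by (intro power_mono) auto
  also have "\<dots> = exp (- (real k * (1 - \<rho>)))"
    by (simp add: exp_of_nat_mult[symmetric] algebra_simps)
  also have "\<dots> \<le> exp (- ln (B / \<epsilon>))"
    using k(1) \<rho> by (simp add: x_def field_simps)
  also have "\<dots> = \<epsilon> / B"
    using B assms by (simp add: exp_minus)
  finally have "\<rho> ^ k * B \<le> \<epsilon>"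
    using B by (simp add: field_simps)
  with e[of k] have hit: "e k \<le> \<epsilon>" by simp
  then show "\<exists>k. e k \<le> \<epsilon>" ..
  have "(LEAST k. e k \<le> \<epsilon>) \<le> k"
    using hit by (rule Least_le)
  with k(2) show "real (LEAST k. e k \<le> \<epsilon>) \<le> ln (B / \<epsilon>) / (1 - \<rho>) + 1"
    unfolding x_def by linarith
qed

text \<open>The right-hand side satisfies the recursion of the sum exactly; the slack is only its
  starting value \<open>1 / (1 - \<rho>)\<close>.\<close>

lemma sum_geometric_batches_le:
  fixes \<rho> :: real
  assumes "0 < \<rho>" "\<rho> < 1"
  shows "(\<Sum>k<K. 1 / \<rho> ^ Suc k) \<le> 1 / (\<rho> ^ K * (1 - \<rho>))"
proof (induction K)
  case 0
  show ?case using assms by simp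
next
  case (Suc K)
  have "1 / (\<rho> ^ K * (1 - \<rho>)) + 1 / \<rho> ^ Suc K = 1 / (\<rho> ^ Suc K * (1 - \<rho>))"
    using assms by (simp add: field_simps)
  with Suc show ?case by simp
qed

text \<open>If the first hit is at \<open>Suc m\<close>, then \<open>e m\<close> still exceeds
  \<epsilon>, hence \<open>1 / \<rho> ^ m\<close> is below \<open>B / \<epsilon>\<close> and the
  largest batches are controlled without a logarithm. The shift from \<open>m\<close> to
  \<open>Suc m\<close> costs the factor \<open>1 / \<rho>\<close>.\<close>

lemma geometric_batch_cost:
  fixes e :: "nat \<Rightarrow> real" and n :: "nat \<Rightarrow> nat"
  assumes e: "\<And>k. e k \<le> \<rho> ^ k * B" and \<rho>: "0 < \<rho>" "\<rho> < 1" and \<epsilon>: "0 < \<epsilon>" and B: "0 < B"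
    and n: "\<And>k. real (n k) \<le> 2 / \<rho> ^ Suc k"
  shows "real (\<Sum>k < (LEAST k. e k \<le> \<epsilon>). n k) \<le> 2 * B / (\<rho> * (1 - \<rho>) * \<epsilon>)"
proof (cases "LEAST k. e k \<le> \<epsilon>")
  case 0
  then show ?thesis using \<rho> \<epsilon> B by simp
next
  case (Suc m)
  have "\<not> e m \<le> \<epsilon>"
    by (rule not_less_Least) (simp add: Suc)
  with e[of m] have m: "\<epsilon> < \<rho> ^ m * B" by simp
  have "real (\<Sum>k<Suc m. n k) \<le> (\<Sum>k<Suc m. 2 / \<rho> ^ Suc k)"
    unfolding of_nat_sum by (rule sum_mono) (rule n)
  also have "\<dots> = 2 * (\<Sum>k<Suc m. 1 / \<rho> ^ Suc k)"
    by (simp add: sum_distrib_left del: sum.lessThan_Suc)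
  also have "\<dots> \<le> 2 * (1 / (\<rho> ^ Suc m * (1 - \<rho>)))"
    using sum_geometric_batches_le[OF \<rho>, of "Suc m"] by linarith
  also have "\<dots> = 2 / (\<rho> * (1 - \<rho>)) * (1 / \<rho> ^ m)"
    by (simp add: field_simps)
  also have "\<dots> \<le> 2 / (\<rho> * (1 - \<rho>)) * (B / \<epsilon>)"
    using m \<rho> \<epsilon> B by (intro mult_left_mono) (simp_all add: field_simps)
  finally show ?thesis
    by (simp add: Suc field_simps del: sum.lessThan_Suc of_nat_sum)
qed

section \<open>Moments of the gradient noise and the one-step error recursion\<close>

context batch_sgd
begin

lemma grad_f_xmin: "grad f xmin = 0"
  using grad_eq_0_at_minimum[OF f_differentiable minimizer] .

lemma eta_le_L: "\<eta> \<le> L"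
  using strong_convexity_le_lipschitz[of "grad f"] grad_f_lipschitz strongly_convex by blast

text \<open>Integrating the conditional bound removes the conditioning. The nonnegative integral is
  bounded first, and integrability is a consequence of its finiteness.\<close>

lemma sample_noise_second_moment:
  assumes jk: "(j, k) \<in> sample_index N"
  shows "integrable M (\<lambda>\<omega>. (norm (sample_noise j k \<omega>))\<^sup>2)"
    and "expectation (\<lambda>\<omega>. (norm (sample_noise j k \<omega>))\<^sup>2) \<le> \<nu>\<^sup>2"
proof -
  interpret past: sigma_finite_subalgebra M "past k"
    by (rule sigma_finite_subalgebra_past)
  note [measurable] = sample_noise_measurable[OF jk]
  let ?g = "\<lambda>\<omega>. ennreal ((norm (sample_noise j k \<omega>))\<^sup>2)"
  \<comment> \<open>The constant factor 1 plays the part of the history-measurable multiplier in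
    \<open>nn_cond_exp_intg\<close>.\<close>
  have "(\<integral>\<^sup>+\<omega>. ?g \<omega> \<partial>M) = (\<integral>\<^sup>+\<omega>. 1 * nn_cond_exp M (past k) ?g \<omega> \<partial>M)"
    by (subst past.nn_cond_exp_intg) simp_all
  also have "\<dots> \<le> (\<integral>\<^sup>+\<omega>. ennreal (\<nu>\<^sup>2) \<partial>M)"
    using variance_bound[OF jk] by (intro nn_integral_mono_AE) (simp add: noise_def)
  also have "\<dots> = ennreal (\<nu>\<^sup>2)"
    by (simp add: emeasure_space_1)
  finally have le: "(\<integral>\<^sup>+\<omega>. ?g \<omega> \<partial>M) \<le> ennreal (\<nu>\<^sup>2)" .
  then show int: "integrable M (\<lambda>\<omega>. (norm (sample_noise j k \<omega>))\<^sup>2)"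
    by (intro integrableI_bounded) (auto simp: ennreal_power intro: le_less_trans)
  from le show "expectation (\<lambda>\<omega>. (norm (sample_noise j k \<omega>))\<^sup>2) \<le> \<nu>\<^sup>2"
    by (subst (asm) nn_integral_eq_integral[OF int]) simp_all
qed

text \<open>Since the gradient vanishes at \<open>xmin\<close>, the Lipschitz bound dominates its
  norm by \<open>L\<close> times the distance to \<open>xmin\<close>.\<close>

lemma grad_f_square_integrable:
  assumes "integrable M (\<lambda>\<omega>. (norm (X k \<omega> - xmin))\<^sup>2)"
  shows "integrable M (\<lambda>\<omega>. (norm (grad f (X k \<omega>)))\<^sup>2)"
proof (rule Bochner_Integration.integrable_bound)
  show "integrable M (\<lambda>\<omega>. L\<^sup>2 * (norm (X k \<omega> - xmin))\<^sup>2)"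
    using assms by simp
  have "(norm (grad f y))\<^sup>2 \<le> L\<^sup>2 * (norm (y - xmin))\<^sup>2" for y
    using power_mono[OF grad_f_lipschitz[of y xmin], of 2] grad_f_xmin
    by (simp add: power_mult_distrib)
  then show "AE \<omega> in M. norm ((norm (grad f (X k \<omega>)))\<^sup>2) \<le> norm (L\<^sup>2 * (norm (X k \<omega> - xmin))\<^sup>2)"
    by simp
qed measurable

text \<open>Unbiasedness concerns the sampled gradient, so the true gradient, which is its own
  conditional expectation, has to be subtracted. Linearity of \<open>real_cond_exp\<close> requires
  both parts to be integrable, which is where \<open>int\<close> enters.\<close>

lemma sample_noise_cond_exp:
  assumes jk: "(j, k) \<in> sample_index N"
    and int: "integrable M (\<lambda>\<omega>. (norm (X k \<omega> - xmin))\<^sup>2)"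
  shows "AE \<omega> in M. real_cond_exp M (past k) (\<lambda>\<omega>. sample_noise j k \<omega> $ i) \<omega> = 0"
proof -
  interpret past: sigma_finite_subalgebra M "past k"
    by (rule sigma_finite_subalgebra_past)
  note [measurable] = sample_noise_measurable[OF jk] X_past_measurable[of k]
  let ?u = "\<lambda>\<omega>. sample_noise j k \<omega> $ i" and ?v = "\<lambda>\<omega>. grad f (X k \<omega>) $ i"
  have gX [measurable]: "(\<lambda>\<omega>. grad f (X k \<omega>)) \<in> borel_measurable M"
    by measurable
  have u: "integrable M ?u"
    using measurable_compose[OF sample_noise_measurable[OF jk] borel_measurable_nth]
      square_integrable_component[OF sample_noise_measurable[OF jk]
        sample_noise_second_moment(1)[OF jk]]
    by (rule square_integrable_imp_integrable)
  have v: "integrable M ?v"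
    using measurable_compose[OF gX borel_measurable_nth]
      square_integrable_component[OF gX grad_f_square_integrable[OF int]]
    by (rule square_integrable_imp_integrable)
  have "(\<lambda>\<omega>. grad f (X k \<omega>)) \<in> borel_measurable (past k)"
    by (rule measurable_compose[OF X_past_measurable grad_f_measurable])
  then have "?v \<in> borel_measurable (past k)"
    by (rule measurable_compose[OF _ borel_measurable_nth])
  then have "AE \<omega> in M. real_cond_exp M (past k) ?v \<omega> = ?v \<omega>"
    by (rule past.real_cond_exp_F_meas[OF v])
  moreover have "AE \<omega> in M. real_cond_exp M (past k) (\<lambda>\<omega>. ?u \<omega> + ?v \<omega>) \<omega> = ?v \<omega>"
    using unbiased[OF jk, of i] by (simp add: noise_def)
  moreover have "AE \<omega> in M. real_cond_exp M (past k) (\<lambda>\<omega>. (?u \<omega> + ?v \<omega>) - ?v \<omega>) \<omega>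
      = real_cond_exp M (past k) (\<lambda>\<omega>. ?u \<omega> + ?v \<omega>) \<omega> - real_cond_exp M (past k) ?v \<omega>"
    using u v by (intro past.real_cond_exp_diff) simp_all
  ultimately show ?thesis
    by eventually_elim simp
qed

text \<open>The factor \<open>h\<close> is pulled out of the conditional expectation. Only the
  product is required to be integrable, because in \<open>sample_noise_orthogonal\<close> the factor
  is known to be integrable only together with the noise.\<close>

lemma past_times_sample_noise:
  assumes jk: "(j, k) \<in> sample_index N"
    and int: "integrable M (\<lambda>\<omega>. (norm (X k \<omega> - xmin))\<^sup>2)"
    and h: "h \<in> borel_measurable (past k)"
    and hn: "integrable M (\<lambda>\<omega>. h \<omega> * sample_noise j k \<omega> $ i)"
  shows "expectation (\<lambda>\<omega>. h \<omega> * sample_noise j k \<omega> $ i) = 0"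
proof -
  interpret past: sigma_finite_subalgebra M "past k"
    by (rule sigma_finite_subalgebra_past)
  have "expectation (\<lambda>\<omega>. h \<omega> * sample_noise j k \<omega> $ i)
      = expectation (\<lambda>\<omega>. h \<omega> * real_cond_exp M (past k) (\<lambda>\<omega>. sample_noise j k \<omega> $ i) \<omega>)"
    by (rule past.real_cond_exp_intg(2)[OF hn h measurable_compose[OF
            sample_noise_measurable[OF jk] borel_measurable_nth], symmetric])
  also have "\<dots> = 0"
    using sample_noise_cond_exp[OF jk int, of i] by (intro integral_eq_zero_AE) auto
  finally show ?thesis .
qed

lemma past_inner_sample_noise:
  assumes jk: "(j, k) \<in> sample_index N"
    and int: "integrable M (\<lambda>\<omega>. (norm (X k \<omega> - xmin))\<^sup>2)"
    and h: "h \<in> borel_measurable (past k)" and h2: "integrable M (\<lambda>\<omega>. (norm (h \<omega>))\<^sup>2)"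
  shows "expectation (\<lambda>\<omega>. h \<omega> \<bullet> sample_noise j k \<omega>) = 0"
proof -
  have h_M: "h \<in> borel_measurable M"
    by (rule measurable_from_subalg[OF subalgebra_past h])
  have prod: "integrable M (\<lambda>\<omega>. h \<omega> $ i * sample_noise j k \<omega> $ i)" for i
    using integrable_inner_square_integrable[of "\<lambda>\<omega>. h \<omega> $ i" M "\<lambda>\<omega>. sample_noise j k \<omega> $ i"]
      square_integrable_component[OF h_M h2, of i]
      square_integrable_component[OF sample_noise_measurable[OF jk] sample_noise_second_moment(1)[OF jk], of i]
      measurable_compose[OF h_M borel_measurable_nth, of i]
      measurable_compose[OF sample_noise_measurable[OF jk] borel_measurable_nth, of i]
    by simp
  have "expectation (\<lambda>\<omega>. h \<omega> \<bullet> sample_noise j k \<omega>)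
      = (\<Sum>i\<in>UNIV. expectation (\<lambda>\<omega>. h \<omega> $ i * sample_noise j k \<omega> $ i))"
    by (simp add: inner_vec_def prod)
  also have "\<dots> = 0"
    using past_times_sample_noise[OF jk int measurable_compose[OF h borel_measurable_nth] prod]
    by simp
  finally show ?thesis .
qed

text \<open>
  Integrating out sample \<open>j\<close> first turns the product of two noise components into a product of
  sample \<open>i\<close>'s noise with a function of \<open>X k\<close>, and this has expectation zero.
\<close>

lemma sample_noise_orthogonal:
  assumes ik: "(i, k) \<in> sample_index N" and jk: "(j, k) \<in> sample_index N" and "i \<noteq> j"
    and int: "integrable M (\<lambda>\<omega>. (norm (X k \<omega> - xmin))\<^sup>2)"
  shows "expectation (\<lambda>\<omega>. sample_noise i k \<omega> \<bullet> sample_noise j k \<omega>) = 0"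
proof -
  have prod: "integrable M (\<lambda>\<omega>. sample_noise i k \<omega> $ l * sample_noise j k \<omega> $ l)" for l
    using integrable_inner_square_integrable[of "\<lambda>\<omega>. sample_noise i k \<omega> $ l" M "\<lambda>\<omega>. sample_noise j k \<omega> $ l"]
      square_integrable_component[OF sample_noise_measurable[OF ik] sample_noise_second_moment(1)[OF ik], of l]
      square_integrable_component[OF sample_noise_measurable[OF jk] sample_noise_second_moment(1)[OF jk], of l]
      measurable_compose[OF sample_noise_measurable[OF ik] borel_measurable_nth, of l]
      measurable_compose[OF sample_noise_measurable[OF jk] borel_measurable_nth, of l]
    by simp
  have zero: "expectation (\<lambda>\<omega>. sample_noise i k \<omega> $ l * sample_noise j k \<omega> $ l) = 0" for l
  proof -
    let ?P = "borel \<Otimes>\<^sub>M borel :: ((real ^ 'm) \<times> (real ^ 'd)) measure"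
    define h :: "(real ^ 'm) \<times> (real ^ 'd) \<Rightarrow> (real ^ 'm) \<times> (real ^ 'd) \<Rightarrow> real"
      where "h p r = noise F f (fst p) (snd p) $ l * noise F f (fst p) (snd r) $ l" for p r
    \<comment> \<open>\<open>g\<close> is the mean noise of sample \<open>j\<close> at a frozen
      point. It is not shown to vanish, since unbiasedness is assumed only along the iterates; it
      suffices that \<open>g (X k \<omega>)\<close> is measurable for the history.\<close>
    define g where "g y = expectation (\<lambda>\<omega>. noise F f y (\<xi>s j k \<omega>) $ l)" for y
    have m1: "(\<lambda>x. noise F f (fst (fst x)) (snd (fst x)) $ l) \<in> borel_measurable (?P \<Otimes>\<^sub>M ?P)"
      by (rule measurable_compose[OF noise_compose_measurable borel_measurable_nth]) measurable
    have m2: "(\<lambda>x. noise F f (fst (fst x)) (snd (snd x)) $ l) \<in> borel_measurable (?P \<Otimes>\<^sub>M ?P)"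
      by (rule measurable_compose[OF noise_compose_measurable borel_measurable_nth]) measurable
    have h: "case_prod h \<in> borel_measurable (?P \<Otimes>\<^sub>M ?P)"
      using borel_measurable_times[OF m1 m2] by (simp add: h_def case_prod_beta')
    note fubini = expectation_indep_var_fubini[OF indep_iterate_samples[OF ik jk \<open>i \<noteq> j\<close>] h]
    have g_h: "expectation (\<lambda>\<omega>'. h (X k \<omega>, \<xi>s i k \<omega>) (0, \<xi>s j k \<omega>'))
        = g (X k \<omega>) * sample_noise i k \<omega> $ l" for \<omega>
      by (simp add: h_def g_def mult.commute)
    have int_h: "integrable M (\<lambda>\<omega>. h (X k \<omega>, \<xi>s i k \<omega>) (0, \<xi>s j k \<omega>))"
      using prod[of l] by (simp add: h_def)
    have "(\<lambda>p. noise F f (fst p) (\<xi>s j k (snd p)) $ l) \<in> borel_measurable (borel \<Otimes>\<^sub>M M)"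
      by (rule measurable_compose[OF noise_compose_measurable borel_measurable_nth])
        (use sample_measurable[OF jk] in measurable)
    then have g: "g \<in> borel_measurable borel"
      unfolding g_def by (intro borel_measurable_lebesgue_integral) (simp add: case_prod_beta')
    have "expectation (\<lambda>\<omega>. sample_noise i k \<omega> $ l * sample_noise j k \<omega> $ l)
        = expectation (\<lambda>\<omega>. h (X k \<omega>, \<xi>s i k \<omega>) (0, \<xi>s j k \<omega>))"
      by (simp add: h_def)
    also have "\<dots> = expectation (\<lambda>\<omega>. g (X k \<omega>) * sample_noise i k \<omega> $ l)"
      using fubini(2)[OF int_h] unfolding g_h .
    also have "\<dots> = 0"
      using fubini(1)[OF int_h] unfolding g_h
      by (rule past_times_sample_noise[OF ik int measurable_compose[OF X_past_measurable g]])
    finally show ?thesis .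
  qed
  show ?thesis
    by (simp add: inner_vec_def prod zero)
qed

text \<open>In the double sum for the squared norm all off-diagonal expectations vanish. The
  \<open>N k\<close> diagonal terms of at most \<open>\<nu>\<^sup>2\<close> meet the prefactor
  \<open>1 / (N k)\<^sup>2\<close>, which leaves a single \<open>1 / N k\<close>.\<close>

lemma batch_error_second_moment:
  assumes int: "integrable M (\<lambda>\<omega>. (norm (X k \<omega> - xmin))\<^sup>2)"
  defines "W \<equiv> \<lambda>\<omega>. batch_error F f (N k) (\<lambda>j. \<xi>s j k \<omega>) (X k \<omega>)"
  shows "W \<in> borel_measurable M"
    and "integrable M (\<lambda>\<omega>. (norm (W \<omega>))\<^sup>2)"
    and "expectation (\<lambda>\<omega>. (norm (W \<omega>))\<^sup>2) \<le> \<nu>\<^sup>2 / real (N k)"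
proof -
  let ?J = "{1..N k}"
  have J: "(j, k) \<in> sample_index N" if "j \<in> ?J" for j
    using that batch_index by blast
  have W: "W = (\<lambda>\<omega>. (1 / real (N k)) *\<^sub>R (\<Sum>j\<in>?J. sample_noise j k \<omega>))"
    unfolding W_def batch_error_eq_noise_average[OF N_pos] ..
  show "W \<in> borel_measurable M"
    unfolding W by (intro borel_measurable_scaleR borel_measurable_const borel_measurable_sum
        sample_noise_measurable J)
  have inner: "integrable M (\<lambda>\<omega>. sample_noise i k \<omega> \<bullet> sample_noise j k \<omega>)"
    if "i \<in> ?J" "j \<in> ?J" for i j
    using J[OF that(1)] J[OF that(2)]
    by (intro integrable_inner_square_integrable sample_noise_measurable sample_noise_second_moment(1))
  have W2: "(norm (W \<omega>))\<^sup>2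
      = (1 / (real (N k))\<^sup>2) * (\<Sum>i\<in>?J. \<Sum>j\<in>?J. sample_noise i k \<omega> \<bullet> sample_noise j k \<omega>)" for \<omega>
  proof -
    have "(norm (\<Sum>j\<in>?J. sample_noise j k \<omega>))\<^sup>2
        = (\<Sum>i\<in>?J. \<Sum>j\<in>?J. sample_noise i k \<omega> \<bullet> sample_noise j k \<omega>)"
      unfolding power2_norm_eq_inner by (subst inner_sum_left) (simp add: inner_sum_right)
    then show ?thesis
      unfolding W by (simp add: power_divide)
  qed
  show "integrable M (\<lambda>\<omega>. (norm (W \<omega>))\<^sup>2)"
    unfolding W2 by (intro integrable_mult_right Bochner_Integration.integrable_sum inner)
  have "expectation (\<lambda>\<omega>. \<Sum>i\<in>?J. \<Sum>j\<in>?J. sample_noise i k \<omega> \<bullet> sample_noise j k \<omega>)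
      = (\<Sum>i\<in>?J. \<Sum>j\<in>?J. expectation (\<lambda>\<omega>. sample_noise i k \<omega> \<bullet> sample_noise j k \<omega>))"
    by (simp add: Bochner_Integration.integral_sum Bochner_Integration.integrable_sum inner
        del: atLeastAtMost_iff)
  also have "\<dots> = (\<Sum>i\<in>?J. \<Sum>j\<in>?J. if j = i then expectation (\<lambda>\<omega>. (norm (sample_noise i k \<omega>))\<^sup>2) else 0)"
    using sample_noise_orthogonal[OF J J _ int]
    by (intro sum.cong) (auto simp: power2_norm_eq_inner)
  also have "\<dots> = (\<Sum>i\<in>?J. expectation (\<lambda>\<omega>. (norm (sample_noise i k \<omega>))\<^sup>2))"
    by (intro sum.cong) simp_all
  also have "\<dots> \<le> (\<Sum>i\<in>?J. \<nu>\<^sup>2)"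
    by (intro sum_mono sample_noise_second_moment(2) J)
  finally have "expectation (\<lambda>\<omega>. \<Sum>i\<in>?J. \<Sum>j\<in>?J. sample_noise i k \<omega> \<bullet> sample_noise j k \<omega>)
      \<le> real (N k) * \<nu>\<^sup>2"
    by simp
  then have "expectation (\<lambda>\<omega>. (norm (W \<omega>))\<^sup>2) \<le> (1 / (real (N k))\<^sup>2) * (real (N k) * \<nu>\<^sup>2)"
    unfolding W2 integral_mult_right_zero by (rule mult_left_mono) simp
  then show "expectation (\<lambda>\<omega>. (norm (W \<omega>))\<^sup>2) \<le> \<nu>\<^sup>2 / real (N k)"
    using N_pos[of k] by (simp add: power2_eq_square)
qed

text \<open>The new error is \<open>T - \<alpha> *\<^sub>R W\<close>, with \<open>T\<close> the
  exact gradient step, which contracts and depends only on the history, so the cross term with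
  \<open>W\<close> has mean zero. Square integrability is carried along because the moment lemmas at
  the next step assume it.\<close>

lemma mse_step:
  assumes "0 < \<alpha>" "\<alpha> \<le> 2 / (\<eta> + L)"
    and int: "integrable M (\<lambda>\<omega>. (norm (X k \<omega> - xmin))\<^sup>2)"
  shows "integrable M (\<lambda>\<omega>. (norm (X (Suc k) \<omega> - xmin))\<^sup>2)"
    and "mse M X xmin (Suc k) \<le> contraction \<alpha> \<eta> L * mse M X xmin k + \<alpha>\<^sup>2 * (\<nu>\<^sup>2 / real (N k))"
proof -
  let ?J = "{1..N k}"
  define T where "T \<omega> = X k \<omega> - xmin - \<alpha> *\<^sub>R grad f (X k \<omega>)" for \<omega>
  define W where "W \<omega> = batch_error F f (N k) (\<lambda>j. \<xi>s j k \<omega>) (X k \<omega>)" for \<omega>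
  note W = batch_error_second_moment[OF int, folded W_def]
  have T_past: "T \<in> borel_measurable (past k)"
    unfolding T_def
    by (intro borel_measurable_diff borel_measurable_scaleR borel_measurable_const
        X_past_measurable measurable_compose[OF X_past_measurable grad_f_measurable])
  then have T_M: "T \<in> borel_measurable M"
    by (rule measurable_from_subalg[OF subalgebra_past])
  have T_le: "(norm (T \<omega>))\<^sup>2 \<le> contraction \<alpha> \<eta> L * (norm (X k \<omega> - xmin))\<^sup>2" for \<omega>
    unfolding T_def
    by (rule gradient_step_contraction[of f "grad f" L \<eta>])
      (use gderiv_grad[OF f_differentiable] grad_f_lipschitz strongly_convex eta_pos eta_le_L
        grad_f_xmin assms in auto)
  have qX: "integrable M (\<lambda>\<omega>. contraction \<alpha> \<eta> L * (norm (X k \<omega> - xmin))\<^sup>2)"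
    using int by simp
  have T_int: "integrable M (\<lambda>\<omega>. (norm (T \<omega>))\<^sup>2)"
    by (rule Bochner_Integration.integrable_bound[OF qX])
      (use T_M T_le in \<open>auto intro: order_trans[OF _ abs_ge_self]\<close>)
  have TW: "expectation (\<lambda>\<omega>. T \<omega> \<bullet> W \<omega>) = 0"
  proof -
    have J: "(j, k) \<in> sample_index N" if "j \<in> ?J" for j
      using that batch_index by blast
    have "T \<omega> \<bullet> W \<omega> = (1 / real (N k)) * (\<Sum>j\<in>?J. T \<omega> \<bullet> sample_noise j k \<omega>)" for \<omega>
      unfolding W_def batch_error_eq_noise_average[OF N_pos] inner_scaleR_right inner_sum_right ..
    moreover have "integrable M (\<lambda>\<omega>. T \<omega> \<bullet> sample_noise j k \<omega>)" if "j \<in> ?J" for j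
      by (rule integrable_inner_square_integrable[OF T_M sample_noise_measurable[OF J[OF that]]
            T_int sample_noise_second_moment(1)[OF J[OF that]]])
    moreover have "expectation (\<lambda>\<omega>. T \<omega> \<bullet> sample_noise j k \<omega>) = 0" if "j \<in> ?J" for j
      by (rule past_inner_sample_noise[OF J[OF that] int T_past T_int])
    ultimately show ?thesis
      by (simp add: Bochner_Integration.integral_sum del: atLeastAtMost_iff)
  qed
  have TW_int: "integrable M (\<lambda>\<omega>. T \<omega> \<bullet> W \<omega>)"
    by (rule integrable_inner_square_integrable[OF T_M W(1) T_int W(2)])
  have step: "(norm (X (Suc k) \<omega> - xmin))\<^sup>2
      = (norm (T \<omega>))\<^sup>2 - 2 * \<alpha> * (T \<omega> \<bullet> W \<omega>) + \<alpha>\<^sup>2 * (norm (W \<omega>))\<^sup>2" if "\<omega> \<in> space M" for \<omega>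
  proof -
    have eq: "X (Suc k) \<omega> - xmin = T \<omega> - \<alpha> *\<^sub>R W \<omega>"
      using X_Suc[OF that, of k] by (simp add: T_def W_def algebra_simps)
    show ?thesis
      unfolding eq power2_norm_eq_inner
      by (simp add: inner_diff_left inner_diff_right inner_commute power2_eq_square algebra_simps)
  qed
  have rhs: "integrable M (\<lambda>\<omega>. (norm (T \<omega>))\<^sup>2 - 2 * \<alpha> * (T \<omega> \<bullet> W \<omega>) + \<alpha>\<^sup>2 * (norm (W \<omega>))\<^sup>2)"
    using T_int TW_int W(2) by simp
  then show "integrable M (\<lambda>\<omega>. (norm (X (Suc k) \<omega> - xmin))\<^sup>2)"
    by (rule Bochner_Integration.integrable_cong[THEN iffD2, rotated -1]) (simp_all add: step)
  have "mse M X xmin (Suc k)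
      = expectation (\<lambda>\<omega>. (norm (T \<omega>))\<^sup>2 - 2 * \<alpha> * (T \<omega> \<bullet> W \<omega>) + \<alpha>\<^sup>2 * (norm (W \<omega>))\<^sup>2)"
    unfolding mse_def by (rule Bochner_Integration.integral_cong) (simp_all add: step)
  also have "\<dots> = expectation (\<lambda>\<omega>. (norm (T \<omega>))\<^sup>2) + \<alpha>\<^sup>2 * expectation (\<lambda>\<omega>. (norm (W \<omega>))\<^sup>2)"
    using T_int TW_int W(2) TW by simp
  also have "\<dots> \<le> expectation (\<lambda>\<omega>. contraction \<alpha> \<eta> L * (norm (X k \<omega> - xmin))\<^sup>2)
      + \<alpha>\<^sup>2 * (\<nu>\<^sup>2 / real (N k))"
    using W(3) T_le by (intro add_mono mult_left_mono integral_mono[OF T_int qX]) simp_all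
  finally show "mse M X xmin (Suc k)
      \<le> contraction \<alpha> \<eta> L * mse M X xmin k + \<alpha>\<^sup>2 * (\<nu>\<^sup>2 / real (N k))"
    by (simp add: mse_def)
qed

lemma initial_square_integrable: "integrable M (\<lambda>\<omega>. (norm (X 0 \<omega> - xmin))\<^sup>2)"
  using square_integrable_add[OF init_measurable _ init_square_integrable, of "\<lambda>_. - xmin"] by simp

end

section \<open>Geometrically growing batches: rate and complexity\<close>

context geometric_batch_sgd
begin

lemma q_bounds: "0 \<le> contraction \<alpha> \<eta> L" "contraction \<alpha> \<eta> L < 1"
  using contraction_bounds[OF eta_pos eta_le_L alpha_pos alpha_le] .

lemma rho_pos: "0 < \<rho>"
  using q_bounds rho_gt by linarith

lemma batch_size_ge: "1 / \<rho> ^ Suc k \<le> real (N k)"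
  and batch_size_le: "real (N k) \<le> 2 / \<rho> ^ Suc k"
proof -
  have N: "N k = nat \<lceil>1 / \<rho> ^ Suc k\<rceil>"
    by (simp only: N_eq power_int_minus power_int_of_nat inverse_eq_divide Suc_eq_plus1)
  have "\<rho> ^ Suc k \<le> 1"
    using rho_pos rho_less by (intro power_le_one) auto
  \<comment> \<open>For a number at least 1, rounding up costs at most a factor of two; this is the
    2 in the upper bound on batch sizes.\<close>
  then have "1 \<le> 1 / \<rho> ^ Suc k"
    using rho_pos by (simp add: field_simps)
  then show "1 / \<rho> ^ Suc k \<le> real (N k)" "real (N k) \<le> 2 / \<rho> ^ Suc k"
    unfolding N by linarith+
qed

lemma square_integrable: "integrable M (\<lambda>\<omega>. (norm (X k \<omega> - xmin))\<^sup>2)"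
  by (induction k) (rule initial_square_integrable, rule mse_step(1)[OF alpha_pos alpha_le])

lemma mse_bound:
  "mse M X xmin k \<le> \<rho> ^ k * (mse M X xmin 0 + \<alpha>\<^sup>2 * \<nu>\<^sup>2 / (1 - contraction \<alpha> \<eta> L / \<rho>))"
proof (rule perturbed_contraction_bound)
  fix k
  have "1 / real (N k) \<le> \<rho> ^ Suc k"
    using batch_size_ge[of k] rho_pos N_pos[of k] by (simp add: field_simps)
  then have "\<alpha>\<^sup>2 * \<nu>\<^sup>2 * (1 / real (N k)) \<le> \<alpha>\<^sup>2 * \<nu>\<^sup>2 * \<rho> ^ Suc k"
    by (rule mult_left_mono) simp
  then show "mse M X xmin (Suc k) \<le> contraction \<alpha> \<eta> L * mse M X xmin k + \<alpha>\<^sup>2 * \<nu>\<^sup>2 * \<rho> ^ Suc k"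
    using mse_step(2)[OF alpha_pos alpha_le square_integrable, of k] by simp
qed (use q_bounds rho_gt in \<open>simp_all add: mse_def\<close>)

text \<open>Translates \<alpha>, \<rho> and \<nu> into the scale-free quantities \<open>a\<close>,
  \<open>c\<close> and \<open>S\<close>, so that \<eta> and \<open>L\<close> survive only through
  their ratio. The gap \<open>1 - \<rho>\<close> is of order \<open>\<eta> / L\<close> because
  \<open>\<eta> + L\<close> is at most \<open>2 * L\<close>.\<close>

lemma scaled_parameters:
  assumes a: "\<alpha> * (\<eta> + L) = a" and c: "1 - \<rho> = c * (1 - contraction \<alpha> \<eta> L)"
    and S: "\<nu>\<^sup>2 \<le> S * (\<eta> * L)"
  shows "0 < a" "0 < c" "c < 1" "1 - c \<le> \<rho>" "c * a / (2 * (L / \<eta>)) \<le> 1 - \<rho>"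
    and "\<alpha>\<^sup>2 * \<nu>\<^sup>2 / (1 - contraction \<alpha> \<eta> L / \<rho>) \<le> a * S / (2 * (1 - c))"
proof -
  define q where "q = contraction \<alpha> \<eta> L"
  note c = c[folded q_def]
  have q: "0 \<le> q" "q < 1" "q < \<rho>"
    using q_bounds rho_gt by (simp_all add: q_def)
  have pos: "0 < \<eta> + L" "0 < \<eta> * L"
    using eta_pos L_pos by simp_all
  show "0 < a"
    using a alpha_pos pos by (metis mult_pos_pos)
  have "0 < c * (1 - q)"
    using c rho_less by simp
  then show c_pos: "0 < c"
    using q by (simp add: zero_less_mult_iff)
  have "c * (1 - q) < 1 * (1 - q)"
    unfolding c[symmetric] using q by simp
  then show c_less: "c < 1"
    by (rule mult_right_less_imp_less) (use q in simp)
  have "c * (1 - q) \<le> c * 1"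
    using q c_pos by (intro mult_left_mono) auto
  then show "1 - c \<le> \<rho>"
    using c by simp
  have q_eq: "1 - q = 2 * a * (\<eta> * L) / (\<eta> + L)\<^sup>2"
    using pos(1) by (simp add: q_def contraction_def a[symmetric] power2_eq_square)
  have "(\<eta> + L)\<^sup>2 \<le> (2 * L)\<^sup>2"
    using eta_pos eta_le_L by (intro power_mono) auto
  then have "2 * a * (\<eta> * L) / (2 * L)\<^sup>2 \<le> 1 - q"
    unfolding q_eq using pos \<open>0 < a\<close> L_pos
    by (intro divide_left_mono mult_pos_pos zero_less_power) auto
  moreover have "2 * a * (\<eta> * L) / (2 * L)\<^sup>2 = a / (2 * (L / \<eta>))"
    using eta_pos L_pos by (simp add: power2_eq_square field_simps)
  ultimately have "c * (a / (2 * (L / \<eta>))) \<le> c * (1 - q)"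
    using c_pos by (intro mult_left_mono) auto
  then show "c * a / (2 * (L / \<eta>)) \<le> 1 - \<rho>"
    using c by simp
  have S_pos: "0 \<le> S"
    using order_trans[OF zero_le_power2 S] pos(2) by (simp add: zero_le_mult_iff)
  \<comment> \<open>With \<open>\<alpha> = a / (\<eta> + L)\<close> the noise term becomes a
    multiple of \<open>1 - q\<close>, which cancels against the same factor in the lower bound for
    \<open>1 - q / \<rho>\<close>.\<close>
  have "\<alpha>\<^sup>2 * \<nu>\<^sup>2 \<le> \<alpha>\<^sup>2 * (S * (\<eta> * L))"
    using S by (rule mult_left_mono) simp
  also have "\<dots> = a * S / 2 * (1 - q)"
  proof -
    have "\<alpha> = a / (\<eta> + L)"
      using pos(1) a by (simp add: eq_divide_eq)
    then show ?thesis
      by (simp add: q_eq power_divide power2_eq_square)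
  qed
  finally have num: "\<alpha>\<^sup>2 * \<nu>\<^sup>2 \<le> a * S / 2 * (1 - q)" .
  have "(1 - c) * (1 - q) = \<rho> - q"
    using c by (simp add: algebra_simps)
  also have "\<dots> \<le> (\<rho> - q) / \<rho>"
    using q rho_pos rho_less by (simp add: le_divide_eq mult_left_le)
  also have "\<dots> = 1 - q / \<rho>"
    using rho_pos by (simp add: field_simps)
  finally have den: "(1 - c) * (1 - q) \<le> 1 - q / \<rho>" .
  have "\<alpha>\<^sup>2 * \<nu>\<^sup>2 / (1 - q / \<rho>) \<le> (a * S / 2 * (1 - q)) / ((1 - c) * (1 - q))"
    using num den q c_less \<open>0 < a\<close> S_pos by (intro frac_le) auto
  also have "\<dots> = a * S / (2 * (1 - c))"
    using q by simp
  finally show "\<alpha>\<^sup>2 * \<nu>\<^sup>2 / (1 - contraction \<alpha> \<eta> L / \<rho>) \<le> a * S / (2 * (1 - c))"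
    by (simp add: q_def)
qed

text \<open>\<open>\<epsilon> \<le> 1 / B\<close> gives ln (B / \<epsilon>) \<le> 2 * ln (1 /
  \<epsilon>), and \<open>\<epsilon> \<le> exp (- 1)\<close> makes ln (1 / \<epsilon>) at least 1,
  so with \<kappa> \<ge> 1 the rounding term is absorbed. The constants then come from
  \<open>1 - \<rho> \<ge> c * a / (2 * \<kappa>)\<close> and, for the oracle count, also from
  \<open>\<rho> \<ge> 1 - c\<close>.\<close>

lemma complexity_bounds:
  assumes a: "\<alpha> * (\<eta> + L) = a" and c: "1 - \<rho> = c * (1 - contraction \<alpha> \<eta> L)"
    and D: "mse M X xmin 0 \<le> D" and S: "\<nu>\<^sup>2 \<le> S * (\<eta> * L)"
    and B: "1 \<le> B" "D + a * S / (2 * (1 - c)) \<le> B"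
    and \<epsilon>: "0 < \<epsilon>" "\<epsilon> \<le> 1 / B" "\<epsilon> \<le> exp (- 1)"
  shows "\<exists>k. mse M X xmin k \<le> \<epsilon>"
    and "real (iteration_complexity M X xmin \<epsilon>) \<le> (4 / (c * a) + 1) * ((L / \<eta>) * ln (1 / \<epsilon>))"
    and "real (oracle_complexity M X xmin N \<epsilon>) \<le> 4 * B / ((1 - c) * (c * a)) * ((L / \<eta>) / \<epsilon>)"
proof -
  note params = scaled_parameters[OF a c S]
  define \<kappa> where "\<kappa> = L / \<eta>"
  have \<kappa>: "1 \<le> \<kappa>"
    using eta_pos eta_le_L by (simp add: \<kappa>_def)
  have ca: "0 < c * a" "c * a / (2 * \<kappa>) \<le> 1 - \<rho>"
    using params by (simp_all add: \<kappa>_def)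
  have "mse M X xmin k \<le> \<rho> ^ k * B" for k
  proof (rule order_trans[OF mse_bound])
    show "\<rho> ^ k * (mse M X xmin 0 + \<alpha>\<^sup>2 * \<nu>\<^sup>2 / (1 - contraction \<alpha> \<eta> L / \<rho>)) \<le> \<rho> ^ k * B"
      using params(6) D B(2) rho_pos by (intro mult_left_mono) auto
  qed
  note mse_B = this
  have "1 / B \<le> 1"
    using B(1) by simp
  then have "\<epsilon> \<le> B"
    using \<epsilon>(2) B(1) by linarith
  note hit = geometric_first_hit[OF mse_B rho_pos rho_less \<epsilon>(1) this]
  show "\<exists>k. mse M X xmin k \<le> \<epsilon>"
    by (rule hit(1))
  define l where "l = ln (1 / \<epsilon>)"
  have "ln \<epsilon> \<le> ln (exp (- 1))"
    using \<epsilon>(1,3) by (subst ln_le_cancel_iff) auto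
  then have l: "1 \<le> l"
    using \<epsilon>(1) by (simp add: l_def ln_div)
  have "B \<le> 1 / \<epsilon>"
    using \<epsilon>(1,2) B(1) by (simp add: field_simps)
  then have "ln B \<le> l"
    unfolding l_def using \<epsilon>(1) B(1) by (subst ln_le_cancel_iff) auto
  then have ln_le: "ln (B / \<epsilon>) \<le> 2 * l"
    using \<epsilon>(1) B(1) by (simp add: l_def ln_div)
  have "real (iteration_complexity M X xmin \<epsilon>) \<le> ln (B / \<epsilon>) / (1 - \<rho>) + 1"
    unfolding iteration_complexity_def by (rule hit(2))
  also have "ln (B / \<epsilon>) / (1 - \<rho>) \<le> 2 * l / (c * a / (2 * \<kappa>))"
    using ln_le ca \<kappa> l by (intro frac_le) auto
  also have "\<dots> = 4 / (c * a) * (\<kappa> * l)"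
    by (simp add: field_simps)
  also have "1 \<le> \<kappa> * l"
    using mult_mono[OF \<kappa> l] \<kappa> by simp
  finally show "real (iteration_complexity M X xmin \<epsilon>) \<le> (4 / (c * a) + 1) * ((L / \<eta>) * ln (1 / \<epsilon>))"
    by (simp add: \<kappa>_def l_def algebra_simps)
  have "real (oracle_complexity M X xmin N \<epsilon>) \<le> 2 * B / (\<rho> * (1 - \<rho>) * \<epsilon>)"
    unfolding oracle_complexity_def iteration_complexity_def
    using B(1) by (intro geometric_batch_cost[OF mse_B rho_pos rho_less \<epsilon>(1) _ batch_size_le]) simp
  also have "\<dots> \<le> 2 * B / ((1 - c) * (c * a / (2 * \<kappa>)) * \<epsilon>)"
    using params(1-4) ca \<kappa> \<epsilon>(1) B(1) rho_pos rho_less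
    by (intro divide_left_mono mult_right_mono mult_mono mult_pos_pos divide_pos_pos) auto
  also have "\<dots> = 4 * B / ((1 - c) * (c * a)) * (\<kappa> / \<epsilon>)"
    by (simp add: field_simps)
  finally show "real (oracle_complexity M X xmin N \<epsilon>)
      \<le> 4 * B / ((1 - c) * (c * a)) * ((L / \<eta>) / \<epsilon>)"
    by (simp add: \<kappa>_def)
qed

end

theorem proposition1:
  shows
   "(\<forall>(M :: 'w measure) (F :: real ^ 'm \<Rightarrow> real ^ 'd \<Rightarrow> real) \<xi> \<xi>s N f xmin X \<alpha> \<eta> L \<nu> \<rho>.
       geometric_batch_sgd M F \<xi> \<xi>s N f xmin X \<alpha> \<eta> L \<nu> \<rho> \<longrightarrow>
       (\<forall>k\<ge>1. integrable M (\<lambda>\<omega>. (norm (X k \<omega> - xmin))\<^sup>2) \<and>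
          mse M X xmin k \<le> \<rho> ^ k * (mse M X xmin 0 + \<alpha>\<^sup>2 * \<nu>\<^sup>2 / (1 - contraction \<alpha> \<eta> L / \<rho>))))
    \<and>
    (\<forall>a c D S :: real. \<exists>C>0. \<exists>\<epsilon>\<^sub>0>0.
       \<forall>(M :: 'w measure) (F :: real ^ 'm \<Rightarrow> real ^ 'd \<Rightarrow> real) \<xi> \<xi>s N f xmin X \<alpha> \<eta> L \<nu> \<rho>.
         geometric_batch_sgd M F \<xi> \<xi>s N f xmin X \<alpha> \<eta> L \<nu> \<rho> \<longrightarrow>
         \<alpha> * (\<eta> + L) = a \<longrightarrow>
         1 - \<rho> = c * (1 - contraction \<alpha> \<eta> L) \<longrightarrow>
         mse M X xmin 0 \<le> D \<longrightarrow>
         \<nu>\<^sup>2 \<le> S * (\<eta> * L) \<longrightarrow>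
         (\<forall>\<epsilon>. 0 < \<epsilon> \<and> \<epsilon> \<le> \<epsilon>\<^sub>0 \<longrightarrow>
            (\<exists>k. mse M X xmin k \<le> \<epsilon>) \<and>
            real (iteration_complexity M X xmin \<epsilon>) \<le> C * ((L / \<eta>) * ln (1 / \<epsilon>)) \<and>
            real (oracle_complexity M X xmin N \<epsilon>) \<le> C * ((L / \<eta>) / \<epsilon>)))"
proof (rule conjI, goal_cases)
  case 1
  show ?case
    by (intro allI impI conjI geometric_batch_sgd.square_integrable geometric_batch_sgd.mse_bound)
next
  case 2
  show ?case
  proof (intro allI)
    fix a c D S :: real
    \<comment> \<open>All constants are fixed before any instance is chosen. For values such as
      \<open>a = 0\<close> or \<open>c = 1\<close> the quotients default to 0, but then no instance
      meets the side conditions. The \<open>max\<close> ensures \<open>1 \<le> B\<close>, and the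
      absolute values and the final 1 keep \<open>C\<close> positive in every case.\<close>
    define B where "B = max 1 (D + a * S / (2 * (1 - c)))"
    define C where "C = \<bar>4 / (c * a) + 1\<bar> + \<bar>4 * B / ((1 - c) * (c * a))\<bar> + 1"
    define \<epsilon>\<^sub>0 :: real where "\<epsilon>\<^sub>0 = min (1 / B) (exp (- 1))"
    have B: "1 \<le> B" "D + a * S / (2 * (1 - c)) \<le> B"
      by (simp_all add: B_def)
    have C: "C > 0" "4 / (c * a) + 1 \<le> C" "4 * B / ((1 - c) * (c * a)) \<le> C"
      by (simp_all add: C_def abs_if)
    have "\<epsilon>\<^sub>0 > 0"
      using B(1) by (simp add: \<epsilon>\<^sub>0_def)
    moreover have "(\<exists>k. mse M X xmin k \<le> \<epsilon>) \<and>
        real (iteration_complexity M X xmin \<epsilon>) \<le> C * ((L / \<eta>) * ln (1 / \<epsilon>)) \<and>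
        real (oracle_complexity M X xmin N \<epsilon>) \<le> C * ((L / \<eta>) / \<epsilon>)"
      if sgd: "geometric_batch_sgd M F \<xi> \<xi>s N f xmin X \<alpha> \<eta> L \<nu> \<rho>"
        and a: "\<alpha> * (\<eta> + L) = a" and c: "1 - \<rho> = c * (1 - contraction \<alpha> \<eta> L)"
        and D: "mse M X xmin 0 \<le> D" and S: "\<nu>\<^sup>2 \<le> S * (\<eta> * L)"
        and \<epsilon>: "0 < \<epsilon>" "\<epsilon> \<le> \<epsilon>\<^sub>0"
      for M :: "'w measure" and F :: "real ^ 'm \<Rightarrow> real ^ 'd \<Rightarrow> real"
        and \<xi> \<xi>s N f xmin X \<alpha> \<eta> L \<nu> \<rho> \<epsilon>
    proof -
      interpret geometric_batch_sgd M F \<xi> \<xi>s N f xmin X \<alpha> \<eta> L \<nu> \<rho>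
        by (rule sgd)
      have \<epsilon>_le: "\<epsilon> \<le> 1 / B" "\<epsilon> \<le> exp (- 1)"
        using \<epsilon>(2) by (simp_all add: \<epsilon>\<^sub>0_def)
      note bounds = complexity_bounds[OF a c D S B \<epsilon>(1) \<epsilon>_le]
      \<comment> \<open>Both target expressions are nonnegative for \<epsilon> \<le> 1, so the
        specific constants may be enlarged to the common \<open>C\<close>.\<close>
      have "\<epsilon> \<le> 1"
        using \<epsilon>_le(1) B(1) by (simp add: order_trans)
      then have nonneg: "0 \<le> (L / \<eta>) * ln (1 / \<epsilon>)" "0 \<le> (L / \<eta>) / \<epsilon>"
        using \<epsilon>(1) L_pos eta_pos by simp_all
      show ?thesis
        using bounds(1) order_trans[OF bounds(2) mult_right_mono[OF C(2) nonneg(1)]]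
          order_trans[OF bounds(3) mult_right_mono[OF C(3) nonneg(2)]] by blast
    qed
    ultimately show "\<exists>C>0. \<exists>\<epsilon>\<^sub>0>0.
       \<forall>(M :: 'w measure) (F :: real ^ 'm \<Rightarrow> real ^ 'd \<Rightarrow> real) \<xi> \<xi>s N f xmin X \<alpha> \<eta> L \<nu> \<rho>.
         geometric_batch_sgd M F \<xi> \<xi>s N f xmin X \<alpha> \<eta> L \<nu> \<rho> \<longrightarrow>
         \<alpha> * (\<eta> + L) = a \<longrightarrow>
         1 - \<rho> = c * (1 - contraction \<alpha> \<eta> L) \<longrightarrow>
         mse M X xmin 0 \<le> D \<longrightarrow>
         \<nu>\<^sup>2 \<le> S * (\<eta> * L) \<longrightarrow>
         (\<forall>\<epsilon>. 0 < \<epsilon> \<and> \<epsilon> \<le> \<epsilon>\<^sub>0 \<longrightarrow>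
            (\<exists>k. mse M X xmin k \<le> \<epsilon>) \<and>
            real (iteration_complexity M X xmin \<epsilon>) \<le> C * ((L / \<eta>) * ln (1 / \<epsilon>)) \<and>
            real (oracle_complexity M X xmin N \<epsilon>) \<le> C * ((L / \<eta>) / \<epsilon>))"
      using C(1) by blast
  qed
qed

end
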